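(* Let $V_{\mathbb H}^R$ be a separable right quaternionic Hilbert space and $A\in\mathcal B(V_{\mathbb H}^R)$. Then $$\sigma_e^S(A)=\{\mathfrak q\in\mathbb H: R_{\mathfrak q}(A)\in\mathcal B(V_{\mathbb H}^R)\setminus\mathcal F(V_{\mathbb H}^R)\}.$$
   Context: $\mathbb H$ denotes the quaternions. A right quaternionic Hilbert space is a right $\mathbb H$-vector space, complete for the norm of an $\mathbb H$-valued inner product $\langle\cdot|\cdot\rangle$ satisfying $\overline{\langle\phi|\psi\rangle}=\langle\psi|\phi\rangle$, $\|\phi\|^2=\langle\phi|\phi\rangle>0$ for $\phi\ne0$, additivity, $\langle\phi|\psi\mathfrak q\rangle=\langle\phi|\psi\rangle\mathfrak q$ and $\langle\phi\mathfrak q|\psi\rangle=\overline{\mathfrak q}\langle\phi|\psi\rangle$. $\mathcal B(V_{\mathbb H}^R)$ is the algebra of bounded right $\mathbb H$-linear operators on $V_{\mathbb H}^R$, $\mathbb I$ is the identity, and $\mathcal B_0(V_{\mathbb H}^R)$ is the closed two-sided ideal of compact operators (closure of the image of the closed unit ball is compact). The Calkin algebra is the unital Banach algebra $\mathcal B(V_{\mathbb H}^R)/\mathcal B_0(V_{\mathbb H}^R)$ with the quotient norm and product, and $\pi:\mathcal B(V_{\mathbb H}^R)\to\mathcal B(V_{\mathbb H}^R)/\mathcal B_0(V_{\mathbb H}^R)$ is the quotient map. For an element $a$ of a unital algebra with unit $1$ and $\mathfrak q\in\mathbb H$, put $R_{\mathfrak q}(a)=a^2-2\,\mathrm{Re}(\mathfrak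 q)a+|\mathfrak q|^2 1$; its $S$-spectrum $\sigma_S(a)$ is the set of $\mathfrak q\in\mathbb H$ for which $R_{\mathfrak q}(a)$ is not invertible. The essential $S$-spectrum of $A$ is $\sigma_e^S(A)=\sigma_S(\pi(A))$, computed in the Calkin algebra. $\mathcal F(V_{\mathbb H}^R)$ is the set of Fredholm operators: those $T\in\mathcal B(V_{\mathbb H}^R)$ with $\ker(T)$ and $V_{\mathbb H}^R/\mathrm{ran}(T)$ finite dimensional over $\mathbb H$. *)

theory Defs
  imports "HOL-Analysis.Analysis" "HOL-Algebra.QuotRing" "HOL-Algebra.Module"
begin

section \<open>Quaternions\<close>

datatype quat = Quat (qRe: real) (qI: real) (qJ: real) (qK: real)

lemma quat_eq_iff: "p = q \<longleftrightarrow> qRe p = qRe q \<and> qI p = qI q \<and> qJ p = qJ q \<and> qK p = qK q"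
  by (auto intro: quat.expand)

definition qcnj :: "quat \<Rightarrow> quat"
  where "qcnj q = Quat (qRe q) (- qI q) (- qJ q) (- qK q)"

instantiation quat :: ring_1
begin

definition "0 = Quat 0 0 0 0"
definition "1 = Quat 1 0 0 0"
definition "p + q = Quat (qRe p + qRe q) (qI p + qI q) (qJ p + qJ q) (qK p + qK q)"
definition "p - q = Quat (qRe p - qRe q) (qI p - qI q) (qJ p - qJ q) (qK p - qK q)"
definition "- q = Quat (- qRe q) (- qI q) (- qJ q) (- qK q)"
definition "p * q = Quat
  (qRe p * qRe q - qI p * qI q - qJ p * qJ q - qK p * qK q)
  (qRe p * qI q + qI p * qRe q + qJ p * qK q - qK p * qJ q)
  (qRe p * qJ q - qI p * qK q + qJ p * qRe q + qK p * qI q)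
  (qRe p * qK q + qI p * qJ q - qJ p * qI q + qK p * qRe q)"

lemmas quat_ring_defs = zero_quat_def one_quat_def plus_quat_def minus_quat_def
  uminus_quat_def times_quat_def

instance
  by standard (simp_all add: quat_ring_defs algebra_simps)

end

instantiation quat :: real_algebra_1
begin

definition "r *\<^sub>R q = Quat (r * qRe q) (r * qI q) (r * qJ q) (r * qK q)"

instance
  by standard (simp_all add: quat_ring_defs scaleR_quat_def algebra_simps)

end

instantiation quat :: real_inner
begin

definition "p \<bullet> q = qRe p * qRe q + qI p * qI q + qJ p * qJ q + qK p * qK q"
definition "norm q = sqrt ((qRe q)\<^sup>2 + (qI q)\<^sup>2 + (qJ q)\<^sup>2 + (qK q)\<^sup>2)"
definition "sgn (q::quat) = q /\<^sub>R norm q"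
definition "dist p q = norm (p - q :: quat)"
definition [code del]:
  "(uniformity :: (quat \<times> quat) filter) = (INF e\<in>{0<..}. principal {(x, y). dist x y < e})"
definition [code del]:
  "open (U :: quat set) \<longleftrightarrow> (\<forall>x\<in>U. eventually (\<lambda>(x', y). x' = x \<longrightarrow> y \<in> U) uniformity)"

instance
proof
  fix x y z :: quat
  show "0 \<le> x \<bullet> x"
    by (simp add: inner_quat_def)
  show "x \<bullet> x = 0 \<longleftrightarrow> x = 0"
    by (simp add: inner_quat_def zero_quat_def quat_eq_iff add_nonneg_eq_0_iff)
  show "norm x = sqrt (x \<bullet> x)"
    by (simp add: inner_quat_def norm_quat_def power2_eq_square)
qed (simp_all add: quat_ring_defs scaleR_quat_def inner_quat_def dist_quat_def sgn_quat_def
       uniformity_quat_def open_quat_def algebra_simps)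

end

instantiation quat :: real_normed_div_algebra
begin

definition "inverse q = qcnj q /\<^sub>R (norm q)\<^sup>2"
definition "p div q = p * inverse (q :: quat)"

instance
proof
  fix p q :: quat
  have sq: "(norm z)\<^sup>2 = (qRe z)\<^sup>2 + (qI z)\<^sup>2 + (qJ z)\<^sup>2 + (qK z)\<^sup>2" for z :: quat
    by (simp add: norm_quat_def)
  have inv: "q * qcnj q = (norm q)\<^sup>2 *\<^sub>R 1" "qcnj q * q = (norm q)\<^sup>2 *\<^sub>R 1"
    unfolding sq
    by (simp_all add: quat_ring_defs qcnj_def scaleR_quat_def power2_eq_square)
  show "q \<noteq> 0 \<Longrightarrow> inverse q * q = 1" "q \<noteq> 0 \<Longrightarrow> q * inverse q = 1"
    by (simp_all add: inverse_quat_def inv)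
  show "inverse (0::quat) = 0"
    by (simp add: inverse_quat_def)
  show "p div q = p * inverse q"
    by (simp add: divide_quat_def)
  have "(norm (p * q))\<^sup>2 = (norm p * norm q)\<^sup>2"
    unfolding power_mult_distrib sq
    by (simp add: times_quat_def power2_eq_square algebra_simps)
  then show "norm (p * q) = norm p * norm q"
    by simp
qed

end


section \<open>Right quaternionic Hilbert spaces\<close>

text \<open>
  The underlying real normed space is tied to the quaternionic structure:
  real scalars act through \<^term>\<open>of_real :: real \<Rightarrow> quat\<close>, and the norm is the one
  of the \<^typ>\<open>quat\<close>-valued inner product. Positivity of \<open>qinner x x\<close> for \<open>x \<noteq> 0\<close> is the
  positivity of the norm.
\<close>

class right_quaternionic_hilbert = banach +
  fixes rscale :: "'a \<Rightarrow> quat \<Rightarrow> 'a"  (infixl \<open>\<cdot>\<^sub>Q\<close> 75)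
    and qinner :: "'a \<Rightarrow> 'a \<Rightarrow> quat"
  assumes rscale_add_left: "(x + y) \<cdot>\<^sub>Q q = x \<cdot>\<^sub>Q q + y \<cdot>\<^sub>Q q"
    and rscale_add_right: "x \<cdot>\<^sub>Q (p + q) = x \<cdot>\<^sub>Q p + x \<cdot>\<^sub>Q q"
    and rscale_rscale: "(x \<cdot>\<^sub>Q p) \<cdot>\<^sub>Q q = x \<cdot>\<^sub>Q (p * q)"
    and rscale_one: "x \<cdot>\<^sub>Q 1 = x"
    and rscale_of_real: "x \<cdot>\<^sub>Q of_real r = r *\<^sub>R x"
    and qcnj_qinner: "qcnj (qinner x y) = qinner y x"
    and qinner_self: "qinner x x = of_real ((norm x)\<^sup>2)"
    and qinner_add_right: "qinner x (y + z) = qinner x y + qinner x z"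
    and qinner_rscale_right: "qinner x (y \<cdot>\<^sub>Q q) = qinner x y * q"
    and qinner_rscale_left: "qinner (x \<cdot>\<^sub>Q q) y = qcnj q * qinner x y"


section \<open>Finite-dimensional right quaternionic vector spaces\<close>

text \<open>
  The library's vector spaces have a commutative scalar field, so subspaces and quotients
  of a right quaternionic vector space are given here by an explicit structure.
\<close>

record 'a quat_space =
  vecs :: "'a set"
  vadd :: "'a \<Rightarrow> 'a \<Rightarrow> 'a"
  vzero :: 'a
  vscale :: "'a \<Rightarrow> quat \<Rightarrow> 'a"

definition quat_subspace :: "'a quat_space \<Rightarrow> 'a set \<Rightarrow> bool"
  where "quat_subspace V W \<longleftrightarrow> W \<subseteq> vecs V \<and> vzero V \<in> W
    \<and> (\<forall>x\<in>W. \<forall>y\<in>W. vadd V x y \<in> W) \<and> (\<forall>x\<in>W. \<forall>q. vscale V x q \<in> W)"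

definition quat_span :: "'a quat_space \<Rightarrow> 'a set \<Rightarrow> 'a set"
  where "quat_span V S = \<Inter>{W. quat_subspace V W \<and> S \<subseteq> W}"

definition quat_finite_dim :: "'a quat_space \<Rightarrow> bool"
  where "quat_finite_dim V \<longleftrightarrow> (\<exists>S. finite S \<and> S \<subseteq> vecs V \<and> quat_span V S = vecs V)"

definition sub_space :: "'v::right_quaternionic_hilbert set \<Rightarrow> 'v quat_space"
  where "sub_space W = \<lparr>vecs = W, vadd = (+), vzero = 0, vscale = (\<cdot>\<^sub>Q)\<rparr>"

text \<open>
  In the quotient by \<open>W\<close>, the scalar multiple of a coset \<open>X\<close> is written \<open>X q + W\<close>,
  because \<open>X q\<close> alone is only \<open>{0}\<close> when \<open>q = 0\<close>.
\<close>

definition quotient_space :: "'v::right_quaternionic_hilbert set \<Rightarrow> 'v set quat_space"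
  where "quotient_space W = \<lparr>
    vecs = range (\<lambda>x. {x + w | w. w \<in> W}),
    vadd = (\<lambda>X Y. {x + y | x y. x \<in> X \<and> y \<in> Y}),
    vzero = W,
    vscale = (\<lambda>X q. {x \<cdot>\<^sub>Q q + w | x w. x \<in> X \<and> w \<in> W})\<rparr>"


section \<open>Bounded, compact and Fredholm operators\<close>

definition bounded_ops :: "(real, 'v \<Rightarrow> 'v::right_quaternionic_hilbert) module"
  where "bounded_ops = \<lparr>
    carrier = {T. bounded_linear T \<and> (\<forall>x q. T (x \<cdot>\<^sub>Q q) = T x \<cdot>\<^sub>Q q)},
    mult = (\<circ>),
    one = id,
    zero = (\<lambda>x. 0),
    add = (\<lambda>S T x. S x + T x),
    smult = (\<lambda>r T x. r *\<^sub>R T x)\<rparr>"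

definition compact_ops :: "('v \<Rightarrow> 'v::right_quaternionic_hilbert) set"
  where "compact_ops = {T \<in> carrier bounded_ops. compact (closure (T ` cball 0 1))}"

definition fredholm_ops :: "('v \<Rightarrow> 'v::right_quaternionic_hilbert) set"
  where "fredholm_ops = {T \<in> carrier bounded_ops.
    quat_finite_dim (sub_space {x. T x = 0}) \<and> quat_finite_dim (quotient_space (range T))}"


lemma ring_bounded_ops: "ring (bounded_ops :: (real, 'v \<Rightarrow> 'v::right_quaternionic_hilbert) module)"
proof (rule ringI)
  show "abelian_group (bounded_ops :: (real, 'v \<Rightarrow> 'v) module)"
  proof (rule abelian_groupI)
    fix T :: "'v \<Rightarrow> 'v" assume T: "T \<in> carrier bounded_ops"
    have neg: "(- x) \<cdot>\<^sub>Q q = - (x \<cdot>\<^sub>Q q)" for x :: 'v and q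
      using rscale_add_left[of x "- x" q] rscale_add_left[of 0 0 q]
      by (metis add.right_inverse add_cancel_right_right minus_unique)
    then have "(\<lambda>x. - T x) \<in> carrier bounded_ops"
      using T by (auto simp: bounded_ops_def intro: bounded_linear_minus)
    then show "\<exists>S\<in>carrier bounded_ops. S \<oplus>\<^bsub>bounded_ops\<^esub> T = \<zero>\<^bsub>bounded_ops\<^esub>"
      by (rule rev_bexI) (simp add: bounded_ops_def)
  next
    have "0 \<cdot>\<^sub>Q q = (0::'v)" for q using rscale_add_left[of 0 0 q] by simp
    then show "\<zero>\<^bsub>bounded_ops\<^esub> \<in> carrier (bounded_ops :: (real, 'v \<Rightarrow> 'v) module)"
      by (simp add: bounded_ops_def)
  qed (auto simp: bounded_ops_def rscale_add_left algebra_simps intro: bounded_linear_add)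
  show "Group.monoid (bounded_ops :: (real, 'v \<Rightarrow> 'v) module)"
  proof (rule monoidI, goal_cases)
    case (1 x y) then show ?case by (auto simp: bounded_ops_def o_def intro: bounded_linear_compose)
  qed (auto simp: bounded_ops_def id_def bounded_linear_ident)
qed (auto simp: bounded_ops_def linear_simps fun_eq_iff)

lemma ideal_compact_ops:
  "ideal (compact_ops :: ('v \<Rightarrow> 'v::right_quaternionic_hilbert) set) bounded_ops"
proof -
  interpret ring "bounded_ops :: (real, 'v \<Rightarrow> 'v) module" by (rule ring_bounded_ops)
  have cl: "compact (closure X)" if "compact K" "X \<subseteq> K" for X K :: "'v set"
    using that compact_Int_closed[OF that(1) closed_closure[of X]]
    by (metis closure_minimal compact_imp_closed inf.absorb_iff2)
  have zero: "\<zero>\<^bsub>bounded_ops\<^esub> \<in> (compact_ops :: ('v \<Rightarrow> 'v) set)"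
    using zero_closed by (auto simp: compact_ops_def intro!: cl[of "{0}"]) (simp add: bounded_ops_def)
  have sum: "S \<oplus>\<^bsub>bounded_ops\<^esub> T \<in> compact_ops"
    if "S \<in> compact_ops" "T \<in> compact_ops" for S T :: "'v \<Rightarrow> 'v"
  proof -
    let ?K = "{x + y | x y. x \<in> closure (S ` cball 0 1) \<and> y \<in> closure (T ` cball 0 1)}"
    have "compact ?K" using that by (intro compact_sums) (auto simp: compact_ops_def)
    moreover have "(S \<oplus>\<^bsub>bounded_ops\<^esub> T) ` cball 0 1 \<subseteq> ?K"
      using closure_subset[of "S ` cball 0 1"] closure_subset[of "T ` cball 0 1"]
      by (auto simp: bounded_ops_def image_subset_iff; blast)
    ultimately show ?thesis using that a_closed cl by (simp add: compact_ops_def)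
  qed
  have left: "B \<otimes>\<^bsub>bounded_ops\<^esub> T \<in> compact_ops"
    if "T \<in> compact_ops" "B \<in> carrier bounded_ops" for B T :: "'v \<Rightarrow> 'v"
  proof -
    let ?K = "B ` closure (T ` cball 0 1)"
    have "bounded_linear B" using that by (simp add: bounded_ops_def)
    then have "compact ?K" using that
      by (intro compact_continuous_image linear_continuous_on) (auto simp: compact_ops_def)
    moreover have "(B \<otimes>\<^bsub>bounded_ops\<^esub> T) ` cball 0 1 \<subseteq> ?K"
      using closure_subset[of "T ` cball 0 1"] by (auto simp: bounded_ops_def)
    ultimately show ?thesis using that m_closed cl by (simp add: compact_ops_def)
  qed
  have right: "T \<otimes>\<^bsub>bounded_ops\<^esub> B \<in> compact_ops"
    if T: "T \<in> compact_ops" and B: "B \<in> carrier bounded_ops" for B T :: "'v \<Rightarrow> 'v"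
  proof -
    have bl: "bounded_linear B" "bounded_linear T" using that by (simp_all add: bounded_ops_def compact_ops_def)
    then obtain K where K: "K > 0" "\<And>x. norm (B x) \<le> norm x * K"
      using bounded_linear.pos_bounded by blast
    let ?K = "(\<lambda>x. K *\<^sub>R x) ` closure (T ` cball 0 1)"
    have "compact ?K" using that
      by (intro compact_continuous_image continuous_intros) (auto simp: compact_ops_def)
    moreover have "(T \<otimes>\<^bsub>bounded_ops\<^esub> B) ` cball 0 1 \<subseteq> ?K"
    proof
      fix y assume "y \<in> (T \<otimes>\<^bsub>bounded_ops\<^esub> B) ` cball 0 1"
      then obtain x where x: "norm x \<le> 1" "y = T (B x)" by (auto simp: bounded_ops_def)
      have "norm (B x) \<le> K" using K(2)[of x] x(1) K(1) by (smt (verit) mult_left_le_one_le mult.commute norm_ge_zero)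
      then have "norm (B x /\<^sub>R K) \<le> 1" using K(1) by (simp add: field_simps)
      moreover have "y = K *\<^sub>R T (B x /\<^sub>R K)" using bl(2) K(1) x(2) by (simp add: linear_simps)
      ultimately show "y \<in> ?K"
        using closure_subset[of "T ` cball 0 1"] by (auto simp: image_subset_iff)
    qed
    ultimately show ?thesis using that m_closed cl by (simp add: compact_ops_def)
  qed
  have sub: "compact_ops \<subseteq> (carrier bounded_ops :: ('v \<Rightarrow> 'v) set)" by (auto simp: compact_ops_def)
  have neg: "\<ominus>\<^bsub>bounded_ops\<^esub> T \<in> compact_ops" if "T \<in> compact_ops" for T :: "'v \<Rightarrow> 'v"
    using left[OF that a_inv_closed[OF one_closed]] that sub l_minus[OF one_closed, of T] by auto
  show ?thesis
  proof (rule idealI)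
    show "subgroup compact_ops (add_monoid (bounded_ops :: (real, 'v \<Rightarrow> 'v) module))"
      using zero sum neg sub by (intro add.subgroupI) (auto simp: a_inv_def)
  qed (use left right ring_axioms in auto)
qed


section \<open>The Calkin algebra and the S-spectrum\<close>

text \<open>
  The Calkin algebra is recorded as a unital real algebra; its norm does not enter the
  definition of the S-spectrum. The real multiple of a coset is formed in the style of
  \<^const>\<open>rcoset_mult\<close>.
\<close>

definition calkin_algebra :: "(real, ('v \<Rightarrow> 'v::right_quaternionic_hilbert) set) module"
  where "calkin_algebra = ring.extend (bounded_ops Quot compact_ops)
    (module.fields (\<lambda>r X. \<Union>T\<in>X. compact_ops +>\<^bsub>bounded_ops\<^esub> (r \<odot>\<^bsub>bounded_ops\<^esub> T)))"

definition calkin_proj ::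
    "('v \<Rightarrow> 'v) \<Rightarrow> ('v \<Rightarrow> 'v::right_quaternionic_hilbert) set"
  where "calkin_proj T = compact_ops +>\<^bsub>bounded_ops\<^esub> T"

definition S_poly :: "(real, 'a) module \<Rightarrow> quat \<Rightarrow> 'a \<Rightarrow> 'a"
  where "S_poly M q a =
    (a [^]\<^bsub>M\<^esub> (2::nat) \<ominus>\<^bsub>M\<^esub> (2 * qRe q) \<odot>\<^bsub>M\<^esub> a) \<oplus>\<^bsub>M\<^esub> (norm q)\<^sup>2 \<odot>\<^bsub>M\<^esub> \<one>\<^bsub>M\<^esub>"

definition S_spectrum :: "(real, 'a) module \<Rightarrow> 'a \<Rightarrow> quat set"
  where "S_spectrum M a = {q. S_poly M q a \<notin> Units M}"

definition essential_S_spectrum :: "('v \<Rightarrow> 'v::right_quaternionic_hilbert) \<Rightarrow> quat set"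
  where "essential_S_spectrum A = S_spectrum calkin_algebra (calkin_proj A)"

end

theory Submission
  imports Defs
begin

text \<open>
  The projection onto the Calkin algebra is a unital homomorphism that respects real multiples, so
  it commutes with the real polynomial \<open>R\<^sub>q\<close> (\<open>S_poly_calkin\<close>). The theorem therefore amounts to
  Atkinson's theorem for \<open>T = R\<^sub>q(A)\<close>: the coset of a bounded operator \<open>T\<close> is invertible if and only if \<open>T\<close>
  is Fredholm (\<open>calkin_proj_unit_iff_fredholm\<close>). Invertibility of the coset means that \<open>T\<close> has a parametrix
  \<open>B\<close>, a bounded operator for which \<open>B T - I\<close> and \<open>T B - I\<close> are compact.

  If \<open>T\<close> has a parametrix, it suffices to see that \<open>I - K\<close> has finite-dimensional kernel and
  cokernel for compact \<open>K\<close> (\<open>id_minus_compact_fredholm\<close>). In a Hilbert space \<open>K\<close> is within norm distance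
  \<open>1/2\<close> of a finite-rank operator \<open>F\<close>, so \<open>I - K = U - F\<close> where \<open>U = I - (K - F)\<close> is bijective by the
  contraction principle. The kernel is contained in the preimage of the range of \<open>F\<close> under \<open>U\<close>, and
  the range together with that of \<open>F\<close> is everything.

  If \<open>T\<close> is Fredholm, a bounded parametrix is obtained from the open mapping theorem: one solves
  \<open>z = T x + c\<close> with \<open>c\<close> in a finite-dimensional complement of the range and removes from \<open>x\<close> its component
  in the kernel (\<open>exists_parametrix\<close>). The finite-rank operators needed in both directions are built from
  orthogonal projections onto finitely generated subspaces (\<open>finite_span_projection\<close>).

  A recurring abbreviation is \<open>qspan S\<close>, the right quaternionic span of \<open>S\<close> in the whole space. Scalars do
  not commute, so linear algebra is either done by hand over the division ring or reduced to
  real scalars.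
\<close>

section \<open>The open mapping theorem\<close>

text \<open>
  By Baire, the closed image of some ball has interior, hence by convexity and symmetry it contains a
  ball around the origin. So every \<open>z\<close> is hit up to an error of \<open>\<parallel>z\<parallel> / 2\<close> by a vector of norm at
  most \<open>K \<parallel>z\<parallel>\<close>; correcting the errors in turn gives an exact preimage as a geometrically convergent
  series.
\<close>
lemma open_mapping_bounded_preimages:
  fixes f :: "'a::banach \<Rightarrow> 'b::banach"
  assumes f: "bounded_linear f" and "surj f"
  obtains K where "\<And>z. \<exists>x. f x = z \<and> norm x \<le> K * norm z"
proof -
  interpret bounded_linear f by fact
  define C where "C n = closure (f ` cball 0 (real n))" for n
  have cover: "(\<Union>n. C n) = UNIV"
  proof -
    have "z \<in> (\<Union>n. C n)" for z
    proof -
      obtain x where x: "z = f x" using \<open>surj f\<close> by (metis surjD)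
      obtain n where "norm x \<le> real n" using real_arch_simple by blast
      then have "z \<in> C n" unfolding C_def x by (intro subsetD[OF closure_subset]) auto
      then show ?thesis by blast
    qed
    then show ?thesis by blast
  qed
  have "\<exists>n. interior (C n) \<noteq> {}"
  proof (rule ccontr)
    assume "\<not> ?thesis"
    then have empty: "closedin euclidean T \<and> euclidean interior_of T = {}" if "T \<in> range C" for T
      using that unfolding euclidean_interior_of closed_closedin[symmetric] by (auto simp: C_def)
    have "euclidean interior_of \<Union>(range C) = {}"
      by (rule Baire_category_alt[OF disjI1[OF completely_metrizable_space_euclidean] _ empty])
        (rule countable_image[OF countableI_type], assumption)
    then show False using cover by simp
  qed
  then obtain n y r where r: "r > 0" and yr: "ball y r \<subseteq> C n"
    by (meson ex_in_conv mem_interior)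
  have conv: "convex (C n)" unfolding C_def
    by (intro convex_closure convex_linear_image linear_axioms convex_cball)
  have sym: "- u \<in> C n" if u: "u \<in> C n" for u
    unfolding C_def closure_approachable
  proof (intro allI impI)
    fix e :: real assume "e > 0"
    then obtain x where "x \<in> cball 0 (real n)" "dist (f x) u < e"
      using u unfolding C_def closure_approachable by blast
    then show "\<exists>v\<in>f ` cball 0 (real n). dist v (- u) < e"
      by (intro bexI[OF _ imageI[of "- x"]]) (auto simp: neg dist_minus)
  qed
  have small: "z \<in> C n" if "norm z < r" for z
  proof -
    have 1: "y + z \<in> C n" and 2: "y - z \<in> C n" using yr that by (auto simp: dist_norm)
    have "(1/2) *\<^sub>R (y + z) + (1/2) *\<^sub>R (- (y - z)) \<in> C n"
      by (rule convexD[OF conv 1 sym[OF 2]]) simp_all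
    also have "(1/2) *\<^sub>R (y + z) + (1/2) *\<^sub>R (- (y - z)) = z"
      by (simp add: algebra_simps flip: scaleR_add_left)
    finally show ?thesis .
  qed
  define K where "K = 2 * real n / r"
  have approx: "\<exists>x. norm x \<le> K * norm z \<and> norm (z - f x) \<le> norm z / 2" for z
  proof (cases "z = 0")
    case False
    \<comment> \<open>The scaling puts \<open>z / s\<close> at norm \<open>r / 2\<close>, inside the ball covered by \<open>C n\<close>.\<close>
    define s where "s = 2 * norm z / r"
    have s: "s > 0" using False r by (simp add: s_def)
    have "norm (z /\<^sub>R s) < r" using s r False by (simp add: s_def field_simps)
    then have "z /\<^sub>R s \<in> closure (f ` cball 0 (real n))" using small C_def by simp
    then obtain w where w: "norm w \<le> real n" "dist (f w) (z /\<^sub>R s) < r / 4"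
      using r unfolding closure_approachable
      by (metis divide_pos_pos imageE mem_cball_0 zero_less_numeral)
    have "norm (z - f (s *\<^sub>R w)) = norm (s *\<^sub>R (z /\<^sub>R s - f w))"
      using s by (simp add: scaleR scaleR_diff_right)
    also have "\<dots> = s * dist (f w) (z /\<^sub>R s)" using s by (simp add: dist_norm norm_minus_commute)
    also have "\<dots> \<le> s * (r / 4)" using w s by (intro mult_left_mono) auto
    finally have "norm (z - f (s *\<^sub>R w)) \<le> norm z / 2" using r by (simp add: s_def)
    moreover have "norm (s *\<^sub>R w) \<le> K * norm z"
      using w(1) s r mult_left_mono[OF w(1), of s] by (simp add: K_def s_def field_simps)
    ultimately show ?thesis by blast
  qed (auto intro!: exI[of _ 0] simp: zero)
  then obtain g where g: "\<And>z. norm (g z) \<le> K * norm z" "\<And>z. norm (z - f (g z)) \<le> norm z / 2"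
    by metis
  have "\<exists>x. f x = z \<and> norm x \<le> 2 * K * norm z" for z
  proof -
    \<comment> \<open>\<open>e k\<close> is what is left of \<open>z\<close> after \<open>k\<close> approximate preimages.\<close>
    define e where "e k = ((\<lambda>u. u - f (g u)) ^^ k) z" for k
    have e_Suc: "e (Suc k) = e k - f (g (e k))" and e0: "e 0 = z" for k by (simp_all add: e_def)
    have e_le: "norm (e k) \<le> norm z * (1/2) ^ k" for k
    proof (induction k)
      case (Suc k)
      then show ?case using g(2)[of "e k"] by (simp add: e_Suc)
    qed (simp add: e0)
    have K0: "K \<ge> 0" using r by (simp add: K_def)
    have ge: "norm (g (e k)) \<le> K * norm z * (1/2) ^ k" for k
      using order_trans[OF g(1)[of "e k"] mult_left_mono[OF e_le K0]] by (simp add: mult.assoc)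
    have geo: "(\<lambda>k. K * norm z * (1/2) ^ k) sums (K * norm z * 2)"
      using sums_mult[OF geometric_sums[of "1/2::real"]] by simp
    have summ: "summable (\<lambda>k. g (e k))"
      by (rule summable_comparison_test'[OF sums_summable[OF geo]]) (use ge in auto)
    have "(\<lambda>N. norm z * (1/2) ^ N) \<longlonglongrightarrow> norm z * 0"
      by (intro tendsto_intros LIMSEQ_power_zero) auto
    then have "e \<longlonglongrightarrow> 0"
      using e_le by (auto intro: Lim_null_comparison[rotated] always_eventually)
    then have "(\<lambda>k. e k - e (Suc k)) sums (e 0 - 0)" by (rule telescope_sums')
    then have "(\<lambda>k. f (g (e k))) sums z" by (simp add: e_Suc e0)
    moreover have "(\<lambda>k. f (g (e k))) sums f (\<Sum>k. g (e k))"
      using sums[OF summable_sums[OF summ]] .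
    ultimately have "f (\<Sum>k. g (e k)) = z" using sums_unique2 by blast
    moreover have "norm (\<Sum>k. g (e k)) \<le> K * norm z * 2"
      using ge suminf_le[OF _ _ sums_summable[OF geo]] summable_norm
        sums_unique[OF geo] summable_comparison_test'[OF sums_summable[OF geo]]
      by (smt (verit) norm_suminf_le sums_summable[OF geo])
    ultimately show ?thesis by (intro exI[of _ "\<Sum>k. g (e k)"]) (simp add: algebra_simps)
  qed
  then show thesis by (rule that)
qed



section \<open>Right quaternionic Hilbert spaces\<close>

lemma rscale_zero_right [simp]: "x \<cdot>\<^sub>Q 0 = (0::'v::right_quaternionic_hilbert)"
  using rscale_of_real[of x 0] by simp

lemma rscale_zero_left [simp]: "0 \<cdot>\<^sub>Q q = (0::'v::right_quaternionic_hilbert)"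
  using rscale_add_left[of 0 0 q] by simp

lemma rscale_minus_left: "(- x) \<cdot>\<^sub>Q q = - (x \<cdot>\<^sub>Q q :: 'v::right_quaternionic_hilbert)"
  using rscale_add_left[of x "- x" q] by (simp add: eq_neg_iff_add_eq_0 add.commute)

lemma rscale_diff_left: "(x - y) \<cdot>\<^sub>Q q = x \<cdot>\<^sub>Q q - (y \<cdot>\<^sub>Q q :: 'v::right_quaternionic_hilbert)"
  using rscale_add_left[of x "- y" q] by (simp add: rscale_minus_left)

lemma rscale_minus_right: "x \<cdot>\<^sub>Q (- q) = - (x \<cdot>\<^sub>Q q :: 'v::right_quaternionic_hilbert)"
  using rscale_add_right[of x q "- q"] by (simp add: eq_neg_iff_add_eq_0 add.commute)

lemma rscale_scaleR_right: "x \<cdot>\<^sub>Q (r *\<^sub>R q) = r *\<^sub>R (x \<cdot>\<^sub>Q q :: 'v::right_quaternionic_hilbert)"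
proof -
  have "r *\<^sub>R q = q * of_real r"
    by (metis Real_Vector_Spaces.of_real_def mult.right_neutral mult_scaleR_right)
  then show ?thesis by (simp add: rscale_of_real flip: rscale_rscale)
qed

text \<open>
  Coordinates reduce questions about \<open>x q\<close>, with \<open>q\<close> a quaternion, to four real scalars.
\<close>
lemma rscale_coords:
  "x \<cdot>\<^sub>Q Quat a b c d = a *\<^sub>R x + b *\<^sub>R (x \<cdot>\<^sub>Q Quat 0 1 0 0) + c *\<^sub>R (x \<cdot>\<^sub>Q Quat 0 0 1 0)
     + d *\<^sub>R (x \<cdot>\<^sub>Q Quat 0 0 0 1 :: 'v::right_quaternionic_hilbert)"
proof -
  have "Quat a b c d = a *\<^sub>R 1 + b *\<^sub>R Quat 0 1 0 0 + c *\<^sub>R Quat 0 0 1 0 + d *\<^sub>R Quat 0 0 0 1"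
    by (simp add: quat_ring_defs scaleR_quat_def)
  then show ?thesis by (simp add: rscale_add_right rscale_scaleR_right rscale_one)
qed

lemma qcnj_mult_self: "qcnj q * q = of_real ((norm q)\<^sup>2)"
  by (simp add: of_real_def norm_quat_def qcnj_def quat_ring_defs scaleR_quat_def power2_eq_square)

lemma norm_rscale: "norm (x \<cdot>\<^sub>Q q :: 'v::right_quaternionic_hilbert) = norm x * norm q"
proof -
  have "of_real ((norm (x \<cdot>\<^sub>Q q))\<^sup>2) = qcnj q * of_real ((norm x)\<^sup>2) * q"
    unfolding qinner_self[symmetric] qinner_rscale_left qinner_rscale_right by (simp add: mult.assoc)
  also have "\<dots> = of_real ((norm x)\<^sup>2) * (qcnj q * q)"
    by (simp add: of_real_def)
  finally have "(of_real ((norm (x \<cdot>\<^sub>Q q))\<^sup>2) :: quat) = of_real ((norm x * norm q)\<^sup>2)"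
    unfolding qcnj_mult_self by (simp add: power_mult_distrib)
  then have "(norm (x \<cdot>\<^sub>Q q))\<^sup>2 = (norm x * norm q)\<^sup>2" by (simp only: of_real_eq_iff)
  then show ?thesis by simp
qed

lemma qcnj_add: "qcnj (p + q) = qcnj p + qcnj q" by (simp add: qcnj_def quat_ring_defs)
lemma qcnj_eq_zero_iff [simp]: "qcnj q = 0 \<longleftrightarrow> q = 0"
  by (cases q) (auto simp: qcnj_def quat_ring_defs)

lemma qinner_add_left: "qinner (x + y) z = qinner x z + qinner y (z::'v::right_quaternionic_hilbert)"
  by (metis qcnj_add qcnj_qinner qinner_add_right)

lemma qinner_diff_left: "qinner (x - y) z = qinner x z - qinner y (z::'v::right_quaternionic_hilbert)"
  using qinner_add_left[of "x - y" y z] by simp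

lemma qinner_zero_right [simp]: "qinner x (0::'v::right_quaternionic_hilbert) = 0"
  using qinner_add_right[of x 0 0] by simp

lemma qinner_minus_right: "qinner x (- y) = - qinner x (y::'v::right_quaternionic_hilbert)"
  using qinner_add_right[of x y "- y"] by (simp add: eq_neg_iff_add_eq_0 add.commute)

lemma qinner_diff_right: "qinner x (y - z) = qinner x y - qinner x (z::'v::right_quaternionic_hilbert)"
  using qinner_add_right[of x y "- z"] by (simp add: qinner_minus_right)

lemma qinner_scaleR_right: "qinner x (r *\<^sub>R y) = r *\<^sub>R qinner x (y::'v::right_quaternionic_hilbert)"
  unfolding rscale_of_real[symmetric] qinner_rscale_right by (simp add: of_real_def)

lemma qinner_eq_zero_sym: "qinner x y = 0 \<longleftrightarrow> qinner y (x::'v::right_quaternionic_hilbert) = 0"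
  by (metis qcnj_eq_zero_iff qcnj_qinner)

lemma norm_add_orthogonal:
  fixes x y :: "'v::right_quaternionic_hilbert"
  assumes "qinner x y = 0"
  shows "(norm (x + y))\<^sup>2 = (norm x)\<^sup>2 + (norm y)\<^sup>2"
proof -
  have "(of_real ((norm (x + y))\<^sup>2) :: quat) = of_real ((norm x)\<^sup>2 + (norm y)\<^sup>2)"
    using assms qinner_eq_zero_sym[of x y]
    unfolding of_real_add qinner_self[symmetric] by (simp add: qinner_add_left qinner_add_right)
  then show ?thesis by (simp only: of_real_eq_iff)
qed

section \<open>Subspaces and spans\<close>

abbreviation qsubspace :: "'v::right_quaternionic_hilbert set \<Rightarrow> bool"
  where "qsubspace \<equiv> quat_subspace (sub_space UNIV)"

abbreviation qspan :: "'v::right_quaternionic_hilbert set \<Rightarrow> 'v set"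
  where "qspan \<equiv> quat_span (sub_space UNIV)"

lemma qsubspace_iff:
  "qsubspace W \<longleftrightarrow> 0 \<in> W \<and> (\<forall>x\<in>W. \<forall>y\<in>W. x + y \<in> W) \<and> (\<forall>x\<in>W. \<forall>q. x \<cdot>\<^sub>Q q \<in> W)"
  by (simp add: quat_subspace_def sub_space_def)

lemma qsubspace_diff: "qsubspace W \<Longrightarrow> x \<in> W \<Longrightarrow> y \<in> W \<Longrightarrow> x - y \<in> W"
  using rscale_minus_right[of y 1] unfolding qsubspace_iff
  by (metis ab_group_add_class.ab_diff_conv_add_uminus rscale_one)

lemma qspan_superset: "S \<subseteq> qspan S"
  by (auto simp: quat_span_def)

lemma qspan_minimal: "S \<subseteq> W \<Longrightarrow> qsubspace W \<Longrightarrow> qspan S \<subseteq> W"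
  by (auto simp: quat_span_def)

lemma qsubspace_qspan: "qsubspace (qspan S)"
  unfolding quat_span_def by (subst qsubspace_iff) (auto simp: qsubspace_iff)

lemma qspan_mono: "S \<subseteq> T \<Longrightarrow> qspan S \<subseteq> qspan T"
  by (meson order_trans qspan_minimal qspan_superset qsubspace_qspan)

lemma qspan_empty: "qspan {} = {0::'v::right_quaternionic_hilbert}"
  using qspan_minimal[of "{}" "{0::'v}"] qsubspace_qspan[of "{}::'v set"]
  by (auto simp: qsubspace_iff)

lemma qspan_insert: "qspan (insert v S) = {c + v \<cdot>\<^sub>Q q | c q. c \<in> qspan S}" (is "_ = ?R")
proof
  have "qsubspace ?R"
    unfolding qsubspace_iff
  proof (intro conjI ballI allI)
    show "0 \<in> ?R"
      using qsubspace_qspan[of S] by (auto simp: qsubspace_iff intro!: exI[of _ 0])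
  next
    fix x y assume "x \<in> ?R" "y \<in> ?R"
    then obtain c p d q where *: "x = c + v \<cdot>\<^sub>Q p" "y = d + v \<cdot>\<^sub>Q q" "c \<in> qspan S" "d \<in> qspan S"
      by blast
    then have "x + y = (c + d) + v \<cdot>\<^sub>Q (p + q)" by (simp add: rscale_add_right algebra_simps)
    moreover have "c + d \<in> qspan S" using * qsubspace_qspan[of S] by (auto simp: qsubspace_iff)
    ultimately show "x + y \<in> ?R" by blast
  next
    fix x r assume "x \<in> ?R"
    then obtain c q where *: "x = c + v \<cdot>\<^sub>Q q" "c \<in> qspan S" by blast
    then have "x \<cdot>\<^sub>Q r = c \<cdot>\<^sub>Q r + v \<cdot>\<^sub>Q (q * r)" by (simp add: rscale_add_left rscale_rscale)
    moreover have "c \<cdot>\<^sub>Q r \<in> qspan S" using * qsubspace_qspan[of S] by (auto simp: qsubspace_iff)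
    ultimately show "x \<cdot>\<^sub>Q r \<in> ?R" by blast
  qed
  moreover have "insert v S \<subseteq> ?R"
  proof -
    have "v = 0 + v \<cdot>\<^sub>Q 1" by (simp add: rscale_one)
    moreover have "s = s + v \<cdot>\<^sub>Q 0" for s by simp
    ultimately show ?thesis
      using qspan_superset[of S] qsubspace_qspan[of S] unfolding qsubspace_iff by blast
  qed
  ultimately show "qspan (insert v S) \<subseteq> ?R" by (rule qspan_minimal[rotated])
  show "?R \<subseteq> qspan (insert v S)"
    using qsubspace_qspan[of "insert v S"] qspan_mono[of S "insert v S"] qspan_superset[of "insert v S"]
    unfolding qsubspace_iff by blast
qed

lemma qsubspace_imp_subspace: "qsubspace W \<Longrightarrow> subspace W"
  unfolding qsubspace_iff subspace_def by (metis rscale_of_real)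

text \<open>
  Over the reals, \<open>qspan S\<close> is spanned by the vectors \<open>s, s i, s j, s k\<close> with \<open>s \<in> S\<close>. So a real basis
  of \<open>W\<close> is finite, and it generates \<open>W\<close> over the quaternions as well.
\<close>
lemma qsubspace_of_finite_qspan:
  fixes S W :: "'v::right_quaternionic_hilbert set"
  assumes "finite S" "qsubspace W" "W \<subseteq> qspan S"
  obtains B where "finite B" "qspan B = W"
proof -
  define T where "T = S \<union> (\<lambda>s. s \<cdot>\<^sub>Q Quat 0 1 0 0) ` S \<union> (\<lambda>s. s \<cdot>\<^sub>Q Quat 0 0 1 0) ` S
    \<union> (\<lambda>s. s \<cdot>\<^sub>Q Quat 0 0 0 1) ` S"
  have "qspan S \<subseteq> span T"
    using \<open>finite S\<close> T_def
  proof (induction S arbitrary: T)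
    case empty
    then show ?case by (simp add: qspan_empty)
  next
    case (insert s S)
    define U where "U = S \<union> (\<lambda>s. s \<cdot>\<^sub>Q Quat 0 1 0 0) ` S \<union> (\<lambda>s. s \<cdot>\<^sub>Q Quat 0 0 1 0) ` S
      \<union> (\<lambda>s. s \<cdot>\<^sub>Q Quat 0 0 0 1) ` S"
    have "qspan S \<subseteq> span U" using insert.IH[OF U_def] .
    moreover have "U \<subseteq> T" by (auto simp: U_def insert.prems)
    ultimately have S: "qspan S \<subseteq> span T" using span_mono by blast
    have "s \<cdot>\<^sub>Q q \<in> span T" for q
    proof -
      have "s \<in> span T" "s \<cdot>\<^sub>Q Quat 0 1 0 0 \<in> span T" "s \<cdot>\<^sub>Q Quat 0 0 1 0 \<in> span T"
        "s \<cdot>\<^sub>Q Quat 0 0 0 1 \<in> span T"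
        by (auto simp: insert.prems intro!: span_base)
      then show ?thesis
        using rscale_coords[of s "qRe q" "qI q" "qJ q" "qK q"] by (simp add: span_add span_scale)
    qed
    then show ?case using S by (auto simp: qspan_insert intro!: span_add)
  qed
  moreover have "finite T" using \<open>finite S\<close> by (simp add: T_def)
  moreover obtain B where B: "B \<subseteq> W" "independent B" "W \<subseteq> span B"
    by (rule maximal_independent_subset)
  ultimately have "finite B"
    using independent_span_bound[of T B] \<open>W \<subseteq> qspan S\<close> by auto
  moreover have "qspan B = W"
    using B qspan_minimal[OF B(1) \<open>qsubspace W\<close>] span_minimal[OF qspan_superset[of B]]
      qsubspace_imp_subspace[OF qsubspace_qspan[of B]] by blast
  ultimately show thesis by (rule that)
qed

text \<open>
  A generator \<open>v\<close> is kept only if it lies outside the sum of \<open>W\<close> and the span of the generators kept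
  so far. If \<open>w = c + v q\<close> were in \<open>W\<close> with \<open>q \<noteq> 0\<close>, then \<open>v = (w - c) q\<^sup>-\<^sup>1\<close> would lie in that sum.
\<close>
lemma finite_complement:
  fixes S W :: "'v::right_quaternionic_hilbert set"
  assumes "finite S" "qsubspace W"
  obtains S' where "S' \<subseteq> S" "{w + c | w c. w \<in> W \<and> c \<in> qspan S} \<subseteq> {w + c | w c. w \<in> W \<and> c \<in> qspan S'}"
    "W \<inter> qspan S' = {0}"
proof -
  define Q where "Q T = {w + c | w c. w \<in> W \<and> c \<in> qspan T}" for T
  note W = \<open>qsubspace W\<close>[unfolded qsubspace_iff]
  have QI: "w + c \<in> Q T" if "w \<in> W" "c \<in> qspan T" for w c T
    using that by (auto simp: Q_def)
  have Q_subspace: "qsubspace (Q T)" for T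
    unfolding qsubspace_iff
  proof (intro conjI ballI allI)
    note C = qsubspace_qspan[of T, unfolded qsubspace_iff]
    show "0 \<in> Q T" using QI[of 0 0 T] W C by simp
    fix x assume "x \<in> Q T"
    then obtain a b where x: "x = a + b" "a \<in> W" "b \<in> qspan T" by (auto simp: Q_def)
    show "x \<cdot>\<^sub>Q q \<in> Q T" for q
      using x W C by (auto simp: rscale_add_left intro!: QI)
    fix y assume "y \<in> Q T"
    then obtain c d where y: "y = c + d" "c \<in> W" "d \<in> qspan T" by (auto simp: Q_def)
    have "x + y = (a + c) + (b + d)" using x y by simp
    also have "\<dots> \<in> Q T" using x y W C by (intro QI) auto
    finally show "x + y \<in> Q T" .
  qed
  have Q_insert: "\<exists>y\<in>Q T. \<exists>q. x = y + v \<cdot>\<^sub>Q q" if "x \<in> Q (insert v T)" for x v T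
    using that by (auto simp: Q_def qspan_insert) (metis add.assoc)
  have "\<exists>S'\<subseteq>S. Q S \<subseteq> Q S' \<and> W \<inter> qspan S' = {0}"
    using \<open>finite S\<close>
  proof induction
    case empty
    then show ?case using W by (intro exI[of _ "{}"]) (auto simp: qspan_empty)
  next
    case (insert v S)
    from insert.IH obtain S' where S': "S' \<subseteq> S" "Q S \<subseteq> Q S'" "W \<inter> qspan S' = {0}"
      by (elim exE conjE) (rule that)
    note Q = Q_subspace[of S', unfolded qsubspace_iff]
    show ?case
    proof (cases "v \<in> Q S'")
      case True
      have "Q (insert v S) \<subseteq> Q S'"
      proof
        fix x assume "x \<in> Q (insert v S)"
        from Q_insert[OF this] obtain y q where "y \<in> Q S" "x = y + v \<cdot>\<^sub>Q q"
          by (elim bexE exE) (rule that)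
        then show "x \<in> Q S'" using S'(2) True Q by (simp add: subset_iff)
      qed
      then show ?thesis using S' by (intro exI[of _ S'] conjI) (simp_all add: subset_insertI2)
    next
      case False
      have "w = 0" if "w \<in> W" "w \<in> qspan (insert v S')" for w
      proof -
        obtain c q where c: "w = c + v \<cdot>\<^sub>Q q" "c \<in> qspan S'" using \<open>w \<in> qspan _\<close> by (auto simp: qspan_insert)
        have "q = 0"
        proof (rule ccontr)
          assume "q \<noteq> 0"
          then have "v = (v \<cdot>\<^sub>Q q) \<cdot>\<^sub>Q inverse q" by (simp add: rscale_rscale rscale_one)
          also have "v \<cdot>\<^sub>Q q = w + c \<cdot>\<^sub>Q (- 1)" using c by (simp add: rscale_minus_right rscale_one)
          finally have v: "v = (w + c \<cdot>\<^sub>Q (- 1)) \<cdot>\<^sub>Q inverse q" .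
          have "w + c \<cdot>\<^sub>Q (- 1) \<in> Q S'"
            using \<open>w \<in> W\<close> c(2) qsubspace_qspan[of S'] by (intro QI) (auto simp: qsubspace_iff)
          with Q have "(w + c \<cdot>\<^sub>Q (- 1)) \<cdot>\<^sub>Q inverse q \<in> Q S'" by simp
          then have "v \<in> Q S'" by (simp only: v[symmetric])
          with False show False by contradiction
        qed
        then show "w = 0" using c \<open>w \<in> W\<close> S'(3) by auto
      qed
      then have "W \<inter> qspan (insert v S') = {0}"
        using W qsubspace_qspan[of "insert v S'"] unfolding qsubspace_iff by blast
      moreover have "Q (insert v S) \<subseteq> Q (insert v S')"
      proof
        fix x assume "x \<in> Q (insert v S)"
        from Q_insert[OF this] obtain y q where "y \<in> Q S" and x: "x = y + v \<cdot>\<^sub>Q q"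
          by (elim bexE exE) (rule that)
        with S'(2) have y: "y \<in> Q S'" by (rule_tac subsetD)
        from y obtain w c where "y = w + c" "w \<in> W" "c \<in> qspan S'" by (auto simp: Q_def)
        then show "x \<in> Q (insert v S')"
          using x QI[of w "c + v \<cdot>\<^sub>Q q" "insert v S'"] by (auto simp: qspan_insert add.assoc)
      qed
      ultimately show ?thesis using S'(1) by (intro exI[of _ "insert v S'"] conjI) auto
    qed
  qed
  then show thesis unfolding Q_def by (elim exE conjE) (rule that)
qed

section \<open>Bounded right-linear operators\<close>

lemma bounded_opsD:
  assumes "T \<in> carrier bounded_ops"
  shows "bounded_linear T" "T (x \<cdot>\<^sub>Q q) = T x \<cdot>\<^sub>Q q"
  using assms by (simp_all add: bounded_ops_def)

lemma bounded_opsI: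
  assumes "bounded_linear T" "\<And>x q. T (x \<cdot>\<^sub>Q q) = T x \<cdot>\<^sub>Q q"
  shows "T \<in> carrier bounded_ops"
  using assms by (simp add: bounded_ops_def)

lemma qsubspace_kernel:
  assumes "T \<in> carrier bounded_ops"
  shows "qsubspace {x. T x = 0}"
proof -
  interpret bounded_linear T using assms by (rule bounded_opsD)
  show ?thesis unfolding qsubspace_iff by (simp add: zero add bounded_opsD(2)[OF assms])
qed

lemma qsubspace_image:
  assumes "T \<in> carrier bounded_ops" "qsubspace W"
  shows "qsubspace (T ` W)"
  unfolding qsubspace_iff
proof (intro conjI ballI allI)
  note W = assms(2)[unfolded qsubspace_iff] and T = linear_simps[OF bounded_opsD(1)[OF assms(1)]]
  show "0 \<in> T ` W" using W by (intro image_eqI[of _ _ 0]) (simp_all add: T)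
  fix x assume "x \<in> T ` W"
  then obtain a where a: "x = T a" "a \<in> W" by blast
  show "x \<cdot>\<^sub>Q q \<in> T ` W" for q
    using a W by (intro image_eqI[of _ _ "a \<cdot>\<^sub>Q q"]) (simp_all add: bounded_opsD(2)[OF assms(1)])
  fix y assume "y \<in> T ` W"
  then obtain b where b: "y = T b" "b \<in> W" by blast
  show "x + y \<in> T ` W"
    using a b W by (intro image_eqI[of _ _ "a + b"]) (simp_all add: T)
qed

lemma qsubspace_UNIV: "qsubspace UNIV"
  by (simp add: qsubspace_iff)

lemma bounded_ops_diff:
  assumes "S \<in> carrier bounded_ops" "T \<in> carrier bounded_ops"
  shows "(\<lambda>x. S x - T x) \<in> carrier bounded_ops"
  using assms by (intro bounded_opsI bounded_linear_sub) (simp_all add: bounded_opsD rscale_diff_left)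

lemma bounded_ops_compose:
  assumes "S \<in> carrier bounded_ops" "T \<in> carrier bounded_ops"
  shows "(\<lambda>x. S (T x)) \<in> carrier bounded_ops"
  using assms by (intro bounded_opsI bounded_linear_compose[of S T]) (simp_all add: bounded_opsD)

lemma bounded_ops_id: "(\<lambda>x. x) \<in> carrier bounded_ops"
  by (simp add: bounded_ops_def bounded_linear_ident)

lemma compact_ops_add:
  assumes "S \<in> compact_ops" "T \<in> compact_ops"
  shows "(\<lambda>x. S x + T x) \<in> compact_ops"
  using additive_subgroup.a_closed[OF ideal.axioms(1)[OF ideal_compact_ops] assms] by (simp add: bounded_ops_def)

lemma compact_ops_compose:
  assumes "S \<in> compact_ops" "T \<in> carrier bounded_ops"
  shows "(\<lambda>x. S (T x)) \<in> compact_ops"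
  using ideal.I_r_closed[OF ideal_compact_ops assms] by (simp add: bounded_ops_def o_def)

lemma compact_opsD: "T \<in> compact_ops \<Longrightarrow> T \<in> carrier bounded_ops"
  by (simp add: compact_ops_def)

section \<open>Orthogonal projections onto finite-dimensional subspaces\<close>

lemma norm_le_norm_add_orthogonal:
  fixes x y :: "'v::right_quaternionic_hilbert"
  assumes "qinner x y = 0"
  shows "norm y \<le> norm (x + y)"
proof (rule power2_le_imp_le)
  show "(norm y)\<^sup>2 \<le> (norm (x + y))\<^sup>2"
    unfolding norm_add_orthogonal[OF assms] by simp
qed simp

text \<open>
  The orthogonal projection onto the line \<open>e \<cdot> quat\<close>; for \<open>e = 0\<close> it is the zero map, so that
  Gram--Schmidt below need not ask whether a generator is redundant.
\<close>
definition ray_projection :: "'v::right_quaternionic_hilbert \<Rightarrow> 'v \<Rightarrow> 'v"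
  where "ray_projection e x = e \<cdot>\<^sub>Q (qinner e x /\<^sub>R (norm e)\<^sup>2)"

lemma ray_projection_orthogonal: "qinner e (x - ray_projection e x) = 0"
proof (cases "e = 0")
  case True
  then show ?thesis using qinner_eq_zero_sym[of e] by simp
next
  case False
  then show ?thesis
    by (simp add: ray_projection_def qinner_diff_right qinner_rscale_right qinner_self
        del: of_real_power flip: scaleR_conv_of_real)
qed

lemma norm_ray_projection_le: "norm (ray_projection e x) \<le> norm x"
proof -
  have "qinner (x - ray_projection e x) e = 0"
    using ray_projection_orthogonal qinner_eq_zero_sym by metis
  then have "qinner (x - ray_projection e x) (ray_projection e x) = 0"
    unfolding ray_projection_def qinner_rscale_right by simp
  from norm_le_norm_add_orthogonal[OF this] show ?thesis by simp
qed

lemma ray_projection_bounded: "ray_projection e \<in> carrier bounded_ops"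
proof (rule bounded_opsI)
  show "bounded_linear (ray_projection e)"
  proof (rule bounded_linear_intro)
    show "norm (ray_projection e x) \<le> norm x * 1" for x
      using norm_ray_projection_le by simp
    show "ray_projection e (x + y) = ray_projection e x + ray_projection e y" for x y
      by (simp only: ray_projection_def qinner_add_right scaleR_add_right rscale_add_right)
    show "ray_projection e (r *\<^sub>R x) = r *\<^sub>R ray_projection e x" for r x
      by (simp only: ray_projection_def qinner_scaleR_right rscale_scaleR_right scaleR_scaleR mult.commute)
  qed
  show "ray_projection e (x \<cdot>\<^sub>Q q) = ray_projection e x \<cdot>\<^sub>Q q" for x q
    by (simp add: ray_projection_def qinner_rscale_right rscale_rscale)
qed

lemma compact_closure_subset:
  fixes K X :: "'a::t2_space set"
  assumes "compact K" "X \<subseteq> K"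
  shows "compact (closure X)"
proof -
  have "closure X \<subseteq> K" using assms by (intro closure_minimal compact_imp_closed)
  then have "K \<inter> closure X = closure X" by (rule Int_absorb1)
  then show ?thesis using compact_Int_closed[OF assms(1) closed_closure, of X] by simp
qed

text \<open>
  The image of the unit ball lies in \<open>{e q. \<parallel>q\<parallel> \<le> M}\<close>, and this set is covered by a continuous image
  of a compact box in four real dimensions.
\<close>
lemma ray_projection_compact: "ray_projection (e::'v::right_quaternionic_hilbert) \<in> compact_ops"
proof (cases "e = 0")
  case True
  then have "ray_projection e ` cball 0 1 \<subseteq> {0}"
    by (auto simp: ray_projection_def)
  then have "compact (closure (ray_projection e ` cball 0 1))"
    by (rule compact_closure_subset[rotated]) simp
  then show ?thesis using ray_projection_bounded by (simp add: compact_ops_def)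
next
  case False
  define M where "M = 1 / norm e"
  define g where "g = (\<lambda>(a, b, c, d). a *\<^sub>R e + b *\<^sub>R (e \<cdot>\<^sub>Q Quat 0 1 0 0) + c *\<^sub>R (e \<cdot>\<^sub>Q Quat 0 0 1 0)
    + d *\<^sub>R (e \<cdot>\<^sub>Q Quat 0 0 0 1))"
  define I where "I = {- M..M}"
  have "compact (g ` (I \<times> I \<times> I \<times> I))"
    unfolding g_def I_def case_prod_unfold
    by (intro compact_continuous_image continuous_intros compact_Times compact_Icc)
  moreover have "ray_projection e ` cball 0 1 \<subseteq> g ` (I \<times> I \<times> I \<times> I)"
  proof
    fix y assume "y \<in> ray_projection e ` cball 0 1"
    then obtain x where x: "norm x \<le> 1" "y = ray_projection e x" by auto
    define q where "q = qinner e x /\<^sub>R (norm e)\<^sup>2"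
    have y: "y = e \<cdot>\<^sub>Q q" by (simp add: x(2) ray_projection_def q_def)
    have "norm e * norm q \<le> 1"
      using norm_ray_projection_le[of e x] x norm_rscale[of e q] y by simp
    then have "norm q \<le> M" using False by (simp add: M_def field_simps)
    moreover have "\<bar>qRe q\<bar> \<le> norm q" "\<bar>qI q\<bar> \<le> norm q" "\<bar>qJ q\<bar> \<le> norm q" "\<bar>qK q\<bar> \<le> norm q"
      by (auto simp: norm_quat_def intro!: real_le_rsqrt)
    ultimately have "qRe q \<in> I" "qI q \<in> I" "qJ q \<in> I" "qK q \<in> I" by (auto simp: I_def)
    moreover have "y = g (qRe q, qI q, qJ q, qK q)"
      using rscale_coords[of e "qRe q" "qI q" "qJ q" "qK q"] by (simp add: g_def y)
    ultimately show "y \<in> g ` (I \<times> I \<times> I \<times> I)" by blast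
  qed
  ultimately have "compact (closure (ray_projection e ` cball 0 1))"
    by (rule compact_closure_subset)
  then show ?thesis using ray_projection_bounded by (simp add: compact_ops_def)
qed

text \<open>
  Gram--Schmidt: a new generator \<open>v\<close> adds to the projection \<open>P\<close> the line spanned by \<open>v - P v\<close>. Being a
  finite sum of projections onto lines, the result is compact.
\<close>
lemma finite_span_projection:
  fixes S :: "'v::right_quaternionic_hilbert set"
  assumes "finite S"
  obtains P where "P \<in> compact_ops" "range P = qspan S" "\<And>x. x \<in> qspan S \<Longrightarrow> P x = x"
    "\<And>x y. qinner (x - P x) (P y) = 0"
proof -
  have "\<exists>P\<in>compact_ops. range P = qspan S \<and> (\<forall>x\<in>qspan S. P x = x) \<and> (\<forall>x y. qinner (x - P x) (P y) = 0)"
    using assms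
  proof induction
    case empty
    have "ray_projection 0 = (\<lambda>x::'v. 0)" by (simp add: ray_projection_def fun_eq_iff)
    then show ?case
      using ray_projection_compact[of "0::'v"] by (intro bexI[of _ "\<lambda>x. 0"]) (auto simp: qspan_empty)
  next
    case (insert v S)
    then obtain P where P: "P \<in> compact_ops" "range P = qspan S" "\<And>x. x \<in> qspan S \<Longrightarrow> P x = x"
      "\<And>x y. qinner (x - P x) (P y) = 0" by metis
    define e where "e = v - P v"
    define R where "R x = P x + ray_projection e x" for x
    interpret P: bounded_linear P using P(1) by (intro bounded_opsD(1) compact_opsD)
    have P_lin: "P (x + y) = P x + P y" "P (x - y) = P x - P y" "P (x \<cdot>\<^sub>Q q) = P x \<cdot>\<^sub>Q q" for x y q
      using P(1) by (simp_all add: P.add P.diff bounded_opsD(2) compact_opsD)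
    have PP: "P (P x) = P x" for x using P(2,3) by blast
    have eP: "qinner e (P x) = 0" for x using P(4) by (simp add: e_def)
    have Pe: "P e = 0" by (simp add: e_def P_lin PP)
    have R_ortho_e: "qinner (x - R x) e = 0" for x
    proof -
      have "qinner e (x - R x) = qinner e (x - ray_projection e x) - qinner e (P x)"
        by (simp add: R_def qinner_diff_right qinner_add_right)
      then show ?thesis using eP ray_projection_orthogonal[of e x] qinner_eq_zero_sym[of e "x - R x"] by simp
    qed
    have R_ortho_P: "qinner (x - R x) (P y) = 0" for x y
    proof -
      have "x - R x = (x - P x) - ray_projection e x" by (simp add: R_def)
      moreover have "qinner (ray_projection e x) (P y) = 0"
        by (simp add: ray_projection_def qinner_rscale_left eP)
      ultimately show ?thesis using P(4)[of x y] by (simp only: qinner_diff_left[of "x - P x"] diff_self)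
    qed
    have "R \<in> compact_ops" unfolding R_def using P(1) ray_projection_compact by (rule compact_ops_add)
    moreover have "qinner (x - R x) (R y) = 0" for x y
      using R_ortho_e R_ortho_P
      by (simp add: R_def[of y] qinner_add_right) (simp add: ray_projection_def qinner_rscale_right)
    moreover have R_fix: "R x = x" if x_in: "x \<in> qspan (insert v S)" for x
    proof -
      obtain c q where x: "x = c + v \<cdot>\<^sub>Q q" "c \<in> qspan S" using x_in by (auto simp: qspan_insert)
      have x': "x = (c + P v \<cdot>\<^sub>Q q) + e \<cdot>\<^sub>Q q" by (simp add: x e_def rscale_diff_left)
      have R_e: "R (e \<cdot>\<^sub>Q q) = e \<cdot>\<^sub>Q q"
        using Pe by (cases "e = 0") (simp_all add: R_def P_lin Pe ray_projection_def qinner_rscale_right qinner_self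
            del: of_real_power flip: scaleR_conv_of_real)
      have in_S: "c + P v \<cdot>\<^sub>Q q \<in> qspan S"
        using x(2) P(2) qsubspace_qspan[of S] unfolding qsubspace_iff by blast
      have R_S: "R y = y" if "y \<in> qspan S" for y
      proof -
        have y: "P y = y" using that P(3) by simp
        then have "qinner e y = 0" using eP[of y] by simp
        then show ?thesis using y by (simp add: R_def ray_projection_def)
      qed
      have R_add: "R (x + y) = R x + R y" for x y
        by (simp add: R_def P_lin ray_projection_def qinner_add_right rscale_add_right scaleR_add_right)
      show ?thesis
        unfolding x' R_add[of "c + P v \<cdot>\<^sub>Q q" "e \<cdot>\<^sub>Q q"] R_e R_S[OF in_S] ..
    qed
    moreover have "range R = qspan (insert v S)"
    proof
      have "e \<in> qspan (insert v S)" "qspan S \<subseteq> qspan (insert v S)"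
        unfolding e_def using P(2) qspan_mono[of S "insert v S"] qspan_superset[of "insert v S"]
        by (auto intro!: qsubspace_diff qsubspace_qspan)
      then show "range R \<subseteq> qspan (insert v S)"
        using P(2) qsubspace_qspan[of "insert v S"] unfolding qsubspace_iff R_def ray_projection_def by blast
      show "qspan (insert v S) \<subseteq> range R" using R_fix by (metis rangeI subsetI)
    qed
    ultimately show ?case by (intro bexI[of _ R] conjI allI ballI)
  qed
  then show thesis using that by (elim bexE conjE) simp
qed

section \<open>Compact perturbations of the identity\<close>

text \<open>
  A finite \<open>1/2\<close>-net of the image of the unit ball spans a space whose orthogonal projection \<open>P\<close>
  satisfies \<open>\<parallel>K - P K\<parallel> \<le> 1/2\<close>: for a net point \<open>y\<close> near \<open>K x\<close>, the vector \<open>K x - P K x\<close> is the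
  component of \<open>K x - y\<close> orthogonal to the range of \<open>P\<close>.
\<close>
lemma compact_op_near_finite_rank:
  fixes K :: "'v::right_quaternionic_hilbert \<Rightarrow> 'v"
  assumes "K \<in> compact_ops"
  obtains P S where "finite S" "P \<in> compact_ops" "range P = qspan S" "\<And>x. norm (K x - P (K x)) \<le> norm x / 2"
proof -
  have K: "K \<in> carrier bounded_ops" and "compact (closure (K ` cball 0 1))"
    using assms by (simp_all add: compact_ops_def)
  then obtain S where S: "finite S" "closure (K ` cball 0 1) \<subseteq> (\<Union>y\<in>S. ball y (1/2))"
    unfolding compact_eq_totally_bounded by (meson half_gt_zero zero_less_one)
  obtain P where P: "P \<in> compact_ops" "range P = qspan S" "\<And>x. x \<in> qspan S \<Longrightarrow> P x = x"
      "\<And>x y. qinner (x - P x) (P y) = 0"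
    by (rule finite_span_projection[OF S(1)]) blast
  interpret K: bounded_linear K using K by (rule bounded_opsD)
  interpret P: bounded_linear P using P(1) by (intro bounded_opsD(1) compact_opsD)
  have unit: "norm (K x - P (K x)) \<le> 1/2" if "norm x \<le> 1" for x
  proof -
    have "K x \<in> closure (K ` cball 0 1)"
      using that closure_subset[of "K ` cball 0 1"] by auto
    then obtain y where y: "y \<in> S" "dist y (K x) < 1/2" using S(2) by auto
    have "P y = y" using P(3) qspan_superset y(1) by blast
    define z where "z = K x - y"
    have "qinner (P z) (z - P z) = 0" using P(4) qinner_eq_zero_sym by blast
    then have "norm (z - P z) \<le> norm z"
      using norm_le_norm_add_orthogonal[of "P z" "z - P z"] by simp
    moreover have "z - P z = K x - P (K x)" by (simp add: z_def P.diff \<open>P y = y\<close>)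
    moreover have "norm z < 1/2" using y(2) by (simp add: z_def dist_norm norm_minus_commute)
    ultimately show ?thesis by simp
  qed
  have "norm (K x - P (K x)) \<le> norm x / 2" for x
  proof (cases "x = 0")
    case False
    have "K (x /\<^sub>R norm x) - P (K (x /\<^sub>R norm x)) = (K x - P (K x)) /\<^sub>R norm x"
      by (simp add: K.scaleR P.scaleR scaleR_diff_right)
    moreover have "norm (x /\<^sub>R norm x) \<le> 1" using False by simp
    ultimately have "norm ((K x - P (K x)) /\<^sub>R norm x) \<le> 1/2" using unit by metis
    then have "norm (K x - P (K x)) / norm x \<le> 1/2"
      by (simp only: norm_scaleR abs_inverse abs_norm_cancel divide_inverse_commute)
    then show ?thesis using False by (simp add: pos_divide_le_eq)
  qed (simp add: K.zero P.zero)
  then show thesis using that S(1) P(1,2) by blast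
qed

text \<open>The solution is the fixed point of the contraction \<open>x \<mapsto> z + D x\<close>.\<close>
lemma id_minus_contraction_bij:
  fixes D :: "'v::banach \<Rightarrow> 'v"
  assumes "bounded_linear D" "\<And>x. norm (D x) \<le> norm x / 2"
  shows "bij (\<lambda>x. x - D x)"
proof -
  interpret bounded_linear D by fact
  have "\<exists>!x. x - D x = z" for z
  proof -
    have "\<exists>!x. z + D x = x"
      using assms(2)[of "_ - _"]
      by (intro banach_fix_type[of "1/2"]) (auto simp: dist_norm diff)
    moreover have "z + D x = x \<longleftrightarrow> x - D x = z" for x by (metis add_diff_cancel_right' diff_add_cancel)
    ultimately show ?thesis by simp
  qed
  then show ?thesis unfolding bij_iff by (intro allI)
qed

text \<open>
  With \<open>K = D + P K\<close> as above, \<open>U = I - D\<close> is bijective and \<open>I - K = U - P K\<close> differs from \<open>U\<close> by an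
  operator with values in the finite-dimensional range of \<open>P\<close>.
\<close>
lemma id_minus_compact_fredholm:
  fixes K :: "'v::right_quaternionic_hilbert \<Rightarrow> 'v"
  assumes "K \<in> compact_ops"
  obtains S T where "finite S" "{x. K x = x} \<subseteq> qspan S" "finite T"
    "\<And>z. \<exists>x. \<exists>c\<in>qspan T. z = (x - K x) + c"
proof -
  obtain P T where P: "finite T" "P \<in> compact_ops" "range P = qspan T"
    "\<And>x. norm (K x - P (K x)) \<le> norm x / 2"
    by (rule compact_op_near_finite_rank[OF assms]) blast
  define D where "D x = K x - P (K x)" for x
  define U where "U x = x - D x" for x
  have K: "K \<in> carrier bounded_ops" using assms by (rule compact_opsD)
  have D: "D \<in> carrier bounded_ops" unfolding D_def
    by (intro bounded_ops_diff bounded_ops_compose[of P K] K compact_opsD P(2))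
  have U: "U \<in> carrier bounded_ops" unfolding U_def by (intro bounded_ops_diff bounded_ops_id D)
  have "bij U" unfolding U_def
    by (intro id_minus_contraction_bij bounded_opsD(1)[OF D]) (use P(4) in \<open>simp add: D_def\<close>)
  have U_eq: "U x = (x - K x) + P (K x)" for x by (simp add: U_def D_def)
  have PT: "P x \<in> qspan T" for x using P(3) by blast
  define V where "V = inv_into UNIV U"
  have "{x. K x = x} \<subseteq> qspan (V ` T)"
  proof
    fix x assume "x \<in> {x. K x = x}"
    then have "U x \<in> qspan T" using U_eq[of x] PT by simp
    moreover have "T \<subseteq> U ` qspan (V ` T)"
    proof
      fix t assume "t \<in> T"
      then have "V t \<in> qspan (V ` T)" by (intro subsetD[OF qspan_superset] imageI)
      moreover have "t = U (V t)" using \<open>bij U\<close> by (simp add: V_def bij_is_surj surj_f_inv_f)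
      ultimately show "t \<in> U ` qspan (V ` T)" by (rule rev_image_eqI)
    qed
    then have "qspan T \<subseteq> U ` qspan (V ` T)"
      by (rule qspan_minimal) (rule qsubspace_image[OF U qsubspace_qspan])
    ultimately obtain y where "U x = U y" "y \<in> qspan (V ` T)" by blast
    then show "x \<in> qspan (V ` T)" using \<open>bij U\<close> by (metis bij_is_inj inj_eq)
  qed
  moreover have "\<exists>x. \<exists>c\<in>qspan T. z = (x - K x) + c" for z
  proof -
    obtain x where "z = U x" using \<open>bij U\<close> by (metis bij_is_surj surjD)
    then show ?thesis using U_eq PT by blast
  qed
  ultimately show thesis using P(1) that[of "V ` T" T] by blast
qed

section \<open>Parametrices\<close>

definition parametrix :: "('v::right_quaternionic_hilbert \<Rightarrow> 'v) \<Rightarrow> ('v \<Rightarrow> 'v) \<Rightarrow> bool"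
  where "parametrix T B \<longleftrightarrow> B \<in> carrier bounded_ops
    \<and> (\<lambda>x. B (T x) - x) \<in> compact_ops \<and> (\<lambda>x. T (B x) - x) \<in> compact_ops"

lemma compact_ops_uminus:
  assumes "K \<in> compact_ops"
  shows "(\<lambda>x. - K x) \<in> compact_ops"
proof -
  have "(\<lambda>x. - x :: 'v::right_quaternionic_hilbert) \<in> carrier bounded_ops"
    by (intro bounded_opsI bounded_linear_minus bounded_linear_ident) (simp add: rscale_minus_left)
  moreover interpret bounded_linear K using assms by (intro bounded_opsD(1) compact_opsD)
  have "(\<lambda>x. K (- x)) = (\<lambda>x. - K x)" by (simp add: neg)
  ultimately show ?thesis using compact_ops_compose[OF assms] by metis
qed

text \<open>
  With \<open>K = I - B T\<close> and \<open>L = I - T B\<close> compact, the kernel of \<open>T\<close> lies in that of \<open>I - K\<close> and the range of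
  \<open>T\<close> contains that of \<open>I - L\<close>.
\<close>
lemma parametrix_imp_finite:
  fixes T :: "'v::right_quaternionic_hilbert \<Rightarrow> 'v"
  assumes "parametrix T B"
  obtains S C where "finite S" "{x. T x = 0} \<subseteq> qspan S" "finite C" "\<And>z. \<exists>x. \<exists>c\<in>qspan C. z = T x + c"
proof -
  have B: "B \<in> carrier bounded_ops" and c: "(\<lambda>x. B (T x) - x) \<in> compact_ops" "(\<lambda>x. T (B x) - x) \<in> compact_ops"
    using assms by (simp_all add: parametrix_def)
  have "(\<lambda>x. x - B (T x)) \<in> compact_ops" "(\<lambda>x. x - T (B x)) \<in> compact_ops"
    using c[THEN compact_ops_uminus] by simp_all
  obtain S where S: "finite S" "{x. x - B (T x) = x} \<subseteq> qspan S"
    by (rule id_minus_compact_fredholm[OF \<open>(\<lambda>x. x - B (T x)) \<in> compact_ops\<close>]) blast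
  obtain C where C: "finite C" "\<And>z. \<exists>x. \<exists>c\<in>qspan C. z = (x - (x - T (B x))) + c"
    by (rule id_minus_compact_fredholm[OF \<open>(\<lambda>x. x - T (B x)) \<in> compact_ops\<close>]) blast
  have "B 0 = 0" by (rule linear_0[OF bounded_linear.linear[OF bounded_opsD(1)[OF B]]])
  then have "{x. T x = 0} \<subseteq> qspan S" using S(2) by auto
  moreover have "\<exists>x. \<exists>c\<in>qspan C. z = T x + c" for z using C(2)[of z] by auto
  ultimately show thesis using that S(1) C(1) by blast
qed

text \<open>
  Let \<open>qspan C'\<close> be a complement of the range of \<open>T\<close>. Every \<open>z\<close> is \<open>T x + c\<close> with \<open>c \<in> qspan C'\<close>, where
  \<open>c\<close> is unique and \<open>x\<close> is unique modulo \<open>ker T\<close>. Hence \<open>B z = x - N x\<close>, with \<open>N\<close> the projection onto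
  \<open>ker T\<close>, is well defined and linear, and \<open>B T - I = - N\<close> and \<open>T B z - z = - c\<close> have finite rank. \<open>B\<close> is
  bounded because the open mapping theorem, applied to the surjection \<open>(x, y) \<mapsto> T x + P y\<close> with \<open>P\<close>
  the projection onto \<open>qspan C'\<close>, provides an \<open>x\<close> with \<open>\<parallel>x\<parallel> \<le> M \<parallel>z\<parallel>\<close>.
\<close>
lemma exists_parametrix:
  fixes T :: "'v::right_quaternionic_hilbert \<Rightarrow> 'v"
  assumes T: "T \<in> carrier bounded_ops" and "finite S" and ker: "{x. T x = 0} = qspan S"
    and "finite C" and cover: "\<And>z. \<exists>x. \<exists>c\<in>qspan C. z = T x + c"
  obtains B where "parametrix T B"
proof -
  interpret T: bounded_linear T using T by (rule bounded_opsD)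
  obtain C' where C': "C' \<subseteq> C" "range T \<inter> qspan C' = {0}"
    "{w + c | w c. w \<in> range T \<and> c \<in> qspan C} \<subseteq> {w + c | w c. w \<in> range T \<and> c \<in> qspan C'}"
    by (rule finite_complement[OF \<open>finite C\<close> qsubspace_image[OF T qsubspace_UNIV]]) blast
  have "finite C'" using C'(1) \<open>finite C\<close> by (rule finite_subset)
  obtain N where N: "N \<in> compact_ops" "range N = qspan S" "\<And>x. x \<in> qspan S \<Longrightarrow> N x = x"
    by (rule finite_span_projection[OF \<open>finite S\<close>]) blast
  obtain P where P: "P \<in> compact_ops" "range P = qspan C'" "\<And>x. x \<in> qspan C' \<Longrightarrow> P x = x"
    by (rule finite_span_projection[OF \<open>finite C'\<close>]) blast
  interpret N: bounded_linear N using N(1) by (intro bounded_opsD(1) compact_opsD)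
  interpret P: bounded_linear P using P(1) by (intro bounded_opsD(1) compact_opsD)
  define \<Psi> where "\<Psi> = (\<lambda>(x, y). T x + P y)"
  have "bounded_linear \<Psi>"
    unfolding \<Psi>_def case_prod_unfold
    by (intro bounded_linear_add bounded_linear_compose[OF T.bounded_linear_axioms bounded_linear_fst]
        bounded_linear_compose[OF P.bounded_linear_axioms bounded_linear_snd])
  moreover have "surj \<Psi>"
  proof -
    have "\<exists>p. z = \<Psi> p" for z
    proof -
      obtain x c where "z = T x + c" "c \<in> qspan C'" using cover[of z] C'(3) by blast
      then have "z = \<Psi> (x, c)" using P(3) by (simp add: \<Psi>_def)
      then show ?thesis ..
    qed
    then show ?thesis by (simp add: surj_def)
  qed
  ultimately obtain M where "\<And>z. \<exists>p. \<Psi> p = z \<and> norm p \<le> M * norm z"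
    by (rule open_mapping_bounded_preimages) blast
  then obtain G where G: "\<And>z. \<Psi> (G z) = z" "\<And>z. norm (G z) \<le> M * norm z" by metis
  define u where "u z = fst (G z)" for z
  define v where "v z = P (snd (G z))" for z
  have split: "T (u z) + v z = z" for z using G(1)[of z] by (simp add: \<Psi>_def u_def v_def case_prod_unfold)
  have v_in: "v z \<in> qspan C'" for z using P(2) v_def by blast
  have v_unique: "v z = c" if "z = T x + c" "c \<in> qspan C'" for z x c
  proof -
    have "T (x - u z) = v z - c" using that(1) split[of z] by (simp add: T.diff algebra_simps)
    moreover have "v z - c \<in> qspan C'" using v_in that(2) by (intro qsubspace_diff qsubspace_qspan)
    ultimately have "v z - c \<in> range T \<inter> qspan C'" by (metis IntI rangeI)
    then show ?thesis using C'(2) by simp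
  qed
  have NT: "x - N x = y - N y" if "T x = T y" for x y
  proof -
    have "x - y \<in> {x. T x = 0}" using that by (simp add: T.diff)
    then have "x - y \<in> qspan S" unfolding ker .
    then show ?thesis using N(3)[of "x - y"] by (simp add: N.diff algebra_simps)
  qed
  have TN: "T (N x) = 0" for x using N(2) ker by blast
  define B where "B z = u z - N (u z)" for z
  have B_unique: "B z = x - N x" if "z = T x + c" "c \<in> qspan C'" for z x c
  proof -
    have "T (u z) = T x" using split[of z] v_unique[OF that] that(1) by simp
    then show ?thesis unfolding B_def by (rule NT)
  qed
  have "bounded_linear B"
  proof -
    have BI: "bounded_linear (\<lambda>x. x - N x)" by (intro bounded_linear_sub bounded_linear_ident N.bounded_linear_axioms)
    then obtain L where L: "L > 0" "\<And>x. norm (x - N x) \<le> norm x * L" using bounded_linear.pos_bounded by blast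
    show ?thesis
    proof (rule bounded_linear_intro)
      fix y z :: 'v and r :: real
      have "B (y + z) = (u y + u z) - N (u y + u z)"
      proof (rule B_unique)
        show "y + z = T (u y + u z) + (v y + v z)"
          using split[of y] split[of z] by (simp add: T.add algebra_simps)
        show "v y + v z \<in> qspan C'" using v_in qsubspace_qspan[of C'] by (simp add: qsubspace_iff)
      qed
      then show "B (y + z) = B y + B z" by (simp add: B_def N.add)
      have "B (r *\<^sub>R z) = (r *\<^sub>R u z) - N (r *\<^sub>R u z)"
      proof (rule B_unique)
        show "r *\<^sub>R z = T (r *\<^sub>R u z) + r *\<^sub>R v z"
          using arg_cong[OF split[of z], of "scaleR r"] by (simp add: T.scaleR scaleR_add_right)
        show "r *\<^sub>R v z \<in> qspan C'"
          using v_in qsubspace_imp_subspace[OF qsubspace_qspan[of C']] by (simp add: subspace_scale)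
      qed
      then show "B (r *\<^sub>R z) = r *\<^sub>R B z" by (simp add: B_def N.scaleR scaleR_diff_right)
      have "norm (u z) \<le> M * norm z"
        using G(2)[of z] norm_fst_le[of "fst (G z)" "snd (G z)"] by (simp add: u_def)
      then have "norm (u z) * L \<le> (M * norm z) * L" using L(1) by (intro mult_right_mono) simp_all
      then show "norm (B z) \<le> norm z * (M * L)"
        using L(2)[of "u z"] by (simp add: B_def mult_ac)
    qed
  qed
  moreover have "B (z \<cdot>\<^sub>Q q) = B z \<cdot>\<^sub>Q q" for z q
  proof -
    have "B (z \<cdot>\<^sub>Q q) = (u z \<cdot>\<^sub>Q q) - N (u z \<cdot>\<^sub>Q q)"
    proof (rule B_unique)
      show "z \<cdot>\<^sub>Q q = T (u z \<cdot>\<^sub>Q q) + v z \<cdot>\<^sub>Q q"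
        using arg_cong[OF split[of z], of "\<lambda>x. x \<cdot>\<^sub>Q q"] by (simp add: bounded_opsD(2)[OF T] rscale_add_left)
      show "v z \<cdot>\<^sub>Q q \<in> qspan C'" using v_in qsubspace_qspan[of C'] by (simp add: qsubspace_iff)
    qed
    then show ?thesis by (simp add: B_def bounded_opsD(2)[OF compact_opsD[OF N(1)]] rscale_diff_left)
  qed
  ultimately have B: "B \<in> carrier bounded_ops" by (rule bounded_opsI)
  have "B (T x) - x = - N x" for x
    using B_unique[of "T x" x 0] qsubspace_qspan[of C'] by (simp add: qsubspace_iff)
  then have 1: "(\<lambda>x. B (T x) - x) \<in> compact_ops" using compact_ops_uminus[OF N(1)] by simp
  have TB: "T (B z) - z = - v z" for z
    using split[of z] by (simp add: B_def T.diff TN algebra_simps)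
  \<comment> \<open>The defect has values in the range of the compact projection \<open>P\<close>, so it equals its own image.\<close>
  have "P (T (B z) - z) = T (B z) - z" for z
    unfolding TB using v_in P(3) by (simp add: P.neg)
  moreover have "(\<lambda>z. T (B z) - z) \<in> carrier bounded_ops"
    by (rule bounded_ops_diff[OF bounded_ops_compose[OF T B] bounded_ops_id])
  then have "(\<lambda>z. P (T (B z) - z)) \<in> compact_ops" by (rule compact_ops_compose[OF P(1)])
  ultimately have "(\<lambda>z. T (B z) - z) \<in> compact_ops" by simp
  then show thesis using 1 B that by (simp add: parametrix_def)
qed

section \<open>Finite-dimensional subspaces and quotients\<close>

lemma quat_finite_dim_sub_space_iff:
  fixes W :: "'v::right_quaternionic_hilbert set"
  assumes W: "qsubspace W"
  shows "quat_finite_dim (sub_space W) \<longleftrightarrow> (\<exists>S. finite S \<and> qspan S = W)"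
proof -
  have sub: "quat_subspace (sub_space W) U \<longleftrightarrow> U \<subseteq> W \<and> qsubspace U" for U
    by (simp add: quat_subspace_def sub_space_def)
  have "quat_span (sub_space W) S = qspan S" if "S \<subseteq> W" for S
  proof
    show "quat_span (sub_space W) S \<subseteq> qspan S"
      unfolding quat_span_def[of "sub_space W"]
      by (intro Inter_lower CollectI) (simp add: sub qspan_minimal[OF that W] qsubspace_qspan qspan_superset)
    show "qspan S \<subseteq> quat_span (sub_space W) S"
      unfolding quat_span_def[of "sub_space W"] by (rule Inter_greatest) (simp add: sub qspan_minimal)
  qed
  then show ?thesis
    unfolding quat_finite_dim_def by (metis sub_space_def quat_space.select_convs(1) qspan_superset)
qed

text \<open>
  Subspaces of the quotient correspond to subspaces of the whole space containing \<open>W\<close>, so a finite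
  set of cosets spans the quotient exactly if their representatives together with \<open>W\<close> generate
  everything.
\<close>
lemma quat_finite_dim_quotient_space_iff:
  fixes W :: "'v::right_quaternionic_hilbert set"
  assumes W: "qsubspace W"
  shows "quat_finite_dim (quotient_space W) \<longleftrightarrow> (\<exists>C. finite C \<and> (\<forall>z. \<exists>w\<in>W. \<exists>c\<in>qspan C. z = w + c))"
proof -
  define p where "p x = {x + w | w. w \<in> W}" for x
  note W' = W[unfolded qsubspace_iff]
  have mem_p: "y \<in> p x \<longleftrightarrow> y - x \<in> W" for x y
    by (auto simp: p_def) (metis add_diff_cancel_left' diff_add_cancel add.commute)
  have p_eq: "p x = p y \<longleftrightarrow> x - y \<in> W" for x y
  proof
    assume "p x = p y"
    then have "x \<in> p y" using mem_p[of x x] W' by simp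
    then show "x - y \<in> W" by (simp add: mem_p)
  next
    assume xy: "x - y \<in> W"
    have "z - x \<in> W \<longleftrightarrow> z - y \<in> W" for z
      using qsubspace_diff[OF W _ xy, of "z - y"] W' xy
      by (metis diff_add_cancel add_diff_eq diff_diff_eq2 diff_add_eq)
    then show "p x = p y" by (auto simp: mem_p)
  qed
  have p0: "W = p 0" by (auto simp: mem_p)
  have padd: "{u + v | u v. u \<in> p x \<and> v \<in> p y} = p (x + y)" for x y
  proof (intro Set.set_eqI iffI)
    fix z assume "z \<in> {u + v | u v. u \<in> p x \<and> v \<in> p y}"
    then obtain u v where uv: "z = u + v" "u - x \<in> W" "v - y \<in> W" by (auto simp: mem_p)
    have "z - (x + y) = (u - x) + (v - y)" using uv(1) by simp
    also have "\<dots> \<in> W" using uv W' by blast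
    finally show "z \<in> p (x + y)" by (simp add: mem_p)
  next
    fix z assume "z \<in> p (x + y)"
    then have "z - y \<in> p x" by (simp add: mem_p algebra_simps)
    moreover have "y \<in> p y" using W' by (simp add: mem_p)
    moreover have "z = (z - y) + y" by simp
    ultimately show "z \<in> {u + v | u v. u \<in> p x \<and> v \<in> p y}" by blast
  qed
  have pscale: "{u \<cdot>\<^sub>Q q + w | u w. u \<in> p x \<and> w \<in> W} = p (x \<cdot>\<^sub>Q q)" for x q
  proof (intro Set.set_eqI iffI)
    fix z assume "z \<in> {u \<cdot>\<^sub>Q q + w | u w. u \<in> p x \<and> w \<in> W}"
    then obtain u w where z: "z = u \<cdot>\<^sub>Q q + w" "u - x \<in> W" "w \<in> W" by (auto simp: mem_p)
    have "z - x \<cdot>\<^sub>Q q = (u - x) \<cdot>\<^sub>Q q + w" by (simp add: z(1) rscale_diff_left)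
    also have "\<dots> \<in> W" using z W' by blast
    finally show "z \<in> p (x \<cdot>\<^sub>Q q)" by (simp add: mem_p)
  next
    fix z assume "z \<in> p (x \<cdot>\<^sub>Q q)"
    then have "z = x \<cdot>\<^sub>Q q + (z - x \<cdot>\<^sub>Q q)" "z - x \<cdot>\<^sub>Q q \<in> W" "x \<in> p x" using W' by (simp_all add: mem_p)
    then show "z \<in> {u \<cdot>\<^sub>Q q + w | u w. u \<in> p x \<and> w \<in> W}" by blast
  qed
  have sub: "quat_subspace (quotient_space W) X \<longleftrightarrow> X \<subseteq> range p \<and> p 0 \<in> X \<and>
      (\<forall>x y. p x \<in> X \<longrightarrow> p y \<in> X \<longrightarrow> p (x + y) \<in> X) \<and> (\<forall>x q. p x \<in> X \<longrightarrow> p (x \<cdot>\<^sub>Q q) \<in> X)" for X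
  proof -
    have *: "(\<forall>Y\<in>X. Q Y) \<longleftrightarrow> (\<forall>x. p x \<in> X \<longrightarrow> Q (p x))" if "X \<subseteq> range p" for Q
      using that by blast
    show ?thesis
      unfolding quat_subspace_def quotient_space_def quat_space.simps p_def[symmetric]
      by (cases "X \<subseteq> range p") (simp_all add: * padd pscale flip: p0)
  qed
  have vecs: "vecs (quotient_space W) = range p" by (simp add: quotient_space_def p_def)
  show ?thesis
  proof
    assume "quat_finite_dim (quotient_space W)"
    then obtain X where X: "finite X" "X \<subseteq> range p" "quat_span (quotient_space W) X = range p"
      unfolding quat_finite_dim_def vecs by blast
    then obtain C where C: "finite C" "X = p ` C" by (meson finite_subset_image)
    note S = qsubspace_qspan[of C, unfolded qsubspace_iff]
    have lift: "\<exists>c\<in>qspan C. p x = p c" if "p x \<in> p ` qspan C" for x using that by blast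
    have "quat_subspace (quotient_space W) (p ` qspan C)"
      unfolding sub
    proof (intro conjI allI impI)
      show "p 0 \<in> p ` qspan C" using S by simp
      fix x assume "p x \<in> p ` qspan C"
      then obtain c where c: "c \<in> qspan C" "p x = p c" by blast
      have "x \<cdot>\<^sub>Q q - c \<cdot>\<^sub>Q q \<in> W" for q
        using c(2) W' by (simp add: p_eq flip: rscale_diff_left)
      then show "p (x \<cdot>\<^sub>Q q) \<in> p ` qspan C" for q
        using c(1) S by (intro image_eqI[of _ _ "c \<cdot>\<^sub>Q q"]) (simp_all add: p_eq)
      fix y assume "p y \<in> p ` qspan C"
      then obtain d where d: "d \<in> qspan C" "p y = p d" by blast
      have "(x - c) + (y - d) \<in> W" using c(2) d(2) W' by (simp add: p_eq)
      then have "p (x + y) = p (c + d)" by (simp add: p_eq algebra_simps)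
      then show "p (x + y) \<in> p ` qspan C" using c(1) d(1) S by simp
    qed auto
    then have "quat_span (quotient_space W) X \<subseteq> p ` qspan C"
      using C(2) qspan_superset[of C] unfolding quat_span_def[of "quotient_space W"] by (intro Inter_lower) blast
    then have "p z \<in> p ` qspan C" for z using X(3) by blast
    then have "\<exists>w\<in>W. \<exists>c\<in>qspan C. z = w + c" for z
      using lift[of z] by (metis p_eq diff_add_cancel)
    then show "\<exists>C. finite C \<and> (\<forall>z. \<exists>w\<in>W. \<exists>c\<in>qspan C. z = w + c)" using C(1) by blast
  next
    assume "\<exists>C. finite C \<and> (\<forall>z. \<exists>w\<in>W. \<exists>c\<in>qspan C. z = w + c)"
    then obtain C where C: "finite C" "\<And>z. \<exists>w\<in>W. \<exists>c\<in>qspan C. z = w + c" by blast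
    have "range p \<subseteq> X" if X: "quat_subspace (quotient_space W) X" "p ` C \<subseteq> X" for X
    proof -
      have "qsubspace {x. p x \<in> X}" using X(1) unfolding sub qsubspace_iff by simp
      then have *: "qspan C \<subseteq> {x. p x \<in> X}" using X(2) by (intro qspan_minimal) auto
      have "p z \<in> X" for z
      proof -
        obtain w c where "w \<in> W" "c \<in> qspan C" "z = w + c" using C(2) by blast
        then have "p z = p c" by (simp add: p_eq)
        then show ?thesis using * \<open>c \<in> qspan C\<close> by auto
      qed
      then show ?thesis by blast
    qed
    then have "range p \<subseteq> quat_span (quotient_space W) (p ` C)"
      unfolding quat_span_def[of "quotient_space W"] by (intro Inter_greatest) simp
    moreover have "quat_span (quotient_space W) (p ` C) \<subseteq> range p"
      unfolding quat_span_def[of "quotient_space W"] by (intro Inter_lower) (auto simp: sub)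
    ultimately show "quat_finite_dim (quotient_space W)"
      unfolding quat_finite_dim_def vecs using C(1) by (intro exI[of _ "p ` C"]) blast
  qed
qed

section \<open>Invertibility in the Calkin algebra\<close>

lemma (in ideal) Quot_unit_iff:
  assumes a: "a \<in> carrier R"
  shows "I +> a \<in> Units (R Quot I) \<longleftrightarrow>
    (\<exists>b\<in>carrier R. b \<otimes> a \<ominus> \<one> \<in> I \<and> a \<otimes> b \<ominus> \<one> \<in> I)"
proof -
  have eq: "I +> (x \<otimes> y) = I +> \<one> \<longleftrightarrow> x \<otimes> y \<ominus> \<one> \<in> I" if "x \<in> carrier R" "y \<in> carrier R" for x y
    using quotient_eq_iff_same_a_r_cos[OF ideal_axioms] that by simp
  have "I +> a \<in> Units (R Quot I) \<longleftrightarrow>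
      (\<exists>X\<in>a_rcosets I. rcoset_mult R I X (I +> a) = I +> \<one> \<and> rcoset_mult R I (I +> a) X = I +> \<one>)"
    using a by (auto simp: Units_def FactRing_def a_rcosetsI[OF a_subset])
  also have "\<dots> \<longleftrightarrow> (\<exists>b\<in>carrier R. I +> (b \<otimes> a) = I +> \<one> \<and> I +> (a \<otimes> b) = I +> \<one>)"
    using a by (auto simp: A_RCOSETS_defs a_r_coset_def[symmetric] rcoset_mult_add)
  also have "\<dots> \<longleftrightarrow> (\<exists>b\<in>carrier R. b \<otimes> a \<ominus> \<one> \<in> I \<and> a \<otimes> b \<ominus> \<one> \<in> I)"
    using a by (simp add: eq cong: bex_cong)
  finally show ?thesis .
qed

lemma bounded_ops_minus:
  fixes S T :: "'v::right_quaternionic_hilbert \<Rightarrow> 'v"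
  assumes "S \<in> carrier bounded_ops" "T \<in> carrier bounded_ops"
  shows "S \<ominus>\<^bsub>bounded_ops\<^esub> T = (\<lambda>x. S x - T x)"
proof -
  interpret ring "bounded_ops :: (real, 'v \<Rightarrow> 'v) module" by (rule ring_bounded_ops)
  have D: "(\<lambda>x. S x - T x) \<in> carrier bounded_ops" using assms by (rule bounded_ops_diff)
  have "S = (\<lambda>x. S x - T x) \<oplus>\<^bsub>bounded_ops\<^esub> T" by (simp add: bounded_ops_def)
  then have "S \<ominus>\<^bsub>bounded_ops\<^esub> T = ((\<lambda>x. S x - T x) \<oplus>\<^bsub>bounded_ops\<^esub> T) \<ominus>\<^bsub>bounded_ops\<^esub> T" by simp
  also have "\<dots> = (\<lambda>x. S x - T x)"
    using D assms(2) by (simp add: a_minus_def a_assoc r_neg)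
  finally show ?thesis .
qed

lemma calkin_simps:
  "carrier calkin_algebra = carrier (bounded_ops Quot compact_ops)"
  "mult calkin_algebra = mult (bounded_ops Quot compact_ops)"
  "one calkin_algebra = one (bounded_ops Quot compact_ops)"
  "add calkin_algebra = add (bounded_ops Quot compact_ops)"
  "zero calkin_algebra = zero (bounded_ops Quot compact_ops)"
  by (simp_all add: calkin_algebra_def ring.defs module.defs)

lemma Units_calkin: "Units calkin_algebra = Units (bounded_ops Quot compact_ops)"
  by (simp add: Units_def calkin_simps)

lemma minus_calkin: "X \<ominus>\<^bsub>calkin_algebra\<^esub> Y = X \<ominus>\<^bsub>bounded_ops Quot compact_ops\<^esub> Y"
  by (simp add: a_minus_def a_inv_def m_inv_def calkin_simps)

lemma smult_bounded_ops: "r \<odot>\<^bsub>bounded_ops\<^esub> T = (\<lambda>x. r *\<^sub>R T x)"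
  by (simp add: bounded_ops_def)

lemma bounded_ops_scaleR:
  assumes "T \<in> carrier bounded_ops"
  shows "(\<lambda>x. r *\<^sub>R T x) \<in> carrier bounded_ops"
proof (rule bounded_opsI)
  show "bounded_linear (\<lambda>x. r *\<^sub>R T x)"
    by (rule bounded_linear_compose[OF bounded_linear_scaleR_right bounded_opsD(1)[OF assms]])
  have "(r *\<^sub>R y) \<cdot>\<^sub>Q q = r *\<^sub>R (y \<cdot>\<^sub>Q q)" for y :: 'a and q
    by (metis mult.left_neutral mult_scaleR_left rscale_of_real rscale_rscale rscale_scaleR_right
        scaleR_conv_of_real)
  then show "r *\<^sub>R T (x \<cdot>\<^sub>Q q) = (r *\<^sub>R T x) \<cdot>\<^sub>Q q" for x q
    by (simp add: bounded_opsD(2)[OF assms])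
qed

lemma compact_ops_scaleR:
  assumes "T \<in> compact_ops"
  shows "(\<lambda>x. r *\<^sub>R T x) \<in> compact_ops"
  using ideal.I_l_closed[OF ideal_compact_ops assms bounded_ops_scaleR[OF bounded_ops_id, of r]]
  by (simp add: bounded_ops_def o_def)

lemma calkin_proj_eq_iff:
  fixes S T :: "'v::right_quaternionic_hilbert \<Rightarrow> 'v"
  assumes "S \<in> carrier bounded_ops" "T \<in> carrier bounded_ops"
  shows "calkin_proj S = calkin_proj T \<longleftrightarrow> (\<lambda>x. S x - T x) \<in> compact_ops"
  using ring.quotient_eq_iff_same_a_r_cos[OF ring_bounded_ops ideal_compact_ops assms]
  unfolding bounded_ops_minus[OF assms] calkin_proj_def by simp

text \<open>
  The real multiple of a coset is a union over all representatives; each of them contributes the same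
  coset because real multiples of compact operators are compact.
\<close>
lemma calkin_smult:
  fixes T :: "'v::right_quaternionic_hilbert \<Rightarrow> 'v"
  assumes T: "T \<in> carrier bounded_ops"
  shows "r \<odot>\<^bsub>calkin_algebra\<^esub> calkin_proj T = calkin_proj (\<lambda>x. r *\<^sub>R T x)"
proof -
  interpret ideal "compact_ops :: ('v \<Rightarrow> 'v) set" bounded_ops by (rule ideal_compact_ops)
  have "calkin_proj (\<lambda>x. r *\<^sub>R S x) = calkin_proj (\<lambda>x. r *\<^sub>R T x)" if "S \<in> calkin_proj T" for S
  proof -
    have S: "S \<in> carrier bounded_ops"
      using that T a_r_coset_subset_G[OF a_subset T] by (auto simp: calkin_proj_def)
    have "calkin_proj S = calkin_proj T"
      using a_repr_independence[OF that[unfolded calkin_proj_def] T] a_subgroup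
      unfolding calkin_proj_def by (simp add: additive_subgroup_axioms)
    then have "(\<lambda>x. r *\<^sub>R (S x - T x)) \<in> compact_ops"
      unfolding calkin_proj_eq_iff[OF S T] by (rule compact_ops_scaleR)
    then show ?thesis
      unfolding calkin_proj_eq_iff[OF bounded_ops_scaleR[OF S] bounded_ops_scaleR[OF T]]
      by (simp add: scaleR_diff_right)
  qed
  moreover have "T \<in> calkin_proj T" unfolding calkin_proj_def by (rule a_rcos_self[OF T])
  ultimately have "(\<Union>S\<in>calkin_proj T. calkin_proj (\<lambda>x. r *\<^sub>R S x)) = calkin_proj (\<lambda>x. r *\<^sub>R T x)"
    by blast
  then show ?thesis
    by (simp add: calkin_algebra_def ring.defs module.defs smult_bounded_ops flip: calkin_proj_def)
qed

text \<open>
  The projection preserves products, differences, real multiples and the unit, hence real polynomials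
  in an operator.
\<close>
lemma S_poly_calkin:
  fixes A :: "'v::right_quaternionic_hilbert \<Rightarrow> 'v"
  assumes A: "A \<in> carrier bounded_ops"
  shows "S_poly bounded_ops q A \<in> carrier bounded_ops"
    and "S_poly calkin_algebra q (calkin_proj A) = calkin_proj (S_poly bounded_ops q A)"
proof -
  interpret ring_hom_ring "bounded_ops :: (real, 'v \<Rightarrow> 'v) module" "bounded_ops Quot compact_ops" calkin_proj
    using ideal.rcos_ring_hom_ring[OF ideal_compact_ops] unfolding calkin_proj_def .
  have sc: "r \<odot>\<^bsub>bounded_ops\<^esub> T \<in> carrier bounded_ops" if "T \<in> carrier bounded_ops" for r and T :: "'v \<Rightarrow> 'v"
    unfolding smult_bounded_ops using that by (rule bounded_ops_scaleR)
  have sm: "r \<odot>\<^bsub>calkin_algebra\<^esub> calkin_proj T = calkin_proj (r \<odot>\<^bsub>bounded_ops\<^esub> T)"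
    if "T \<in> carrier bounded_ops" for r and T :: "'v \<Rightarrow> 'v"
    unfolding smult_bounded_ops using that by (rule calkin_smult)
  have sm_one: "r \<odot>\<^bsub>calkin_algebra\<^esub> \<one>\<^bsub>bounded_ops Quot compact_ops\<^esub>
      = calkin_proj (r \<odot>\<^bsub>bounded_ops\<^esub> (\<one>\<^bsub>bounded_ops\<^esub> :: 'v \<Rightarrow> 'v))" for r
    using sm[OF R.one_closed] by simp
  show "S_poly bounded_ops q A \<in> carrier bounded_ops"
    unfolding S_poly_def using A by (simp add: sc)
  have pow: "X [^]\<^bsub>calkin_algebra\<^esub> (2::nat) = X [^]\<^bsub>bounded_ops Quot compact_ops\<^esub> (2::nat)" for X :: "('v \<Rightarrow> 'v) set"
    by (simp add: nat_pow_def calkin_simps)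
  have minus: "calkin_proj (S \<ominus>\<^bsub>bounded_ops\<^esub> T) = calkin_proj S \<ominus>\<^bsub>bounded_ops Quot compact_ops\<^esub> calkin_proj T"
    if "S \<in> carrier bounded_ops" "T \<in> carrier bounded_ops" for S T :: "'v \<Rightarrow> 'v"
    using that by (simp add: a_minus_def)
  show "S_poly calkin_algebra q (calkin_proj A) = calkin_proj (S_poly bounded_ops q A)"
    unfolding S_poly_def pow minus_calkin calkin_simps(3)[folded hom_one] calkin_simps(4)
    using A by (simp add: sm sm_one sc minus hom_nat_pow)
qed

section \<open>Atkinson's theorem\<close>

lemma calkin_proj_unit_iff_parametrix:
  fixes T :: "'v::right_quaternionic_hilbert \<Rightarrow> 'v"
  assumes T: "T \<in> carrier bounded_ops"
  shows "calkin_proj T \<in> Units calkin_algebra \<longleftrightarrow> (\<exists>B. parametrix T B)"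
proof -
  interpret ring "bounded_ops :: (real, 'v \<Rightarrow> 'v) module" by (rule ring_bounded_ops)
  have minus_one: "S \<otimes>\<^bsub>bounded_ops\<^esub> R \<ominus>\<^bsub>bounded_ops\<^esub> \<one>\<^bsub>bounded_ops\<^esub> = (\<lambda>x. S (R x) - x)"
    if "S \<in> carrier bounded_ops" "R \<in> carrier bounded_ops" for S R :: "'v \<Rightarrow> 'v"
    using bounded_ops_minus[OF m_closed[OF that] one_closed] by (simp add: bounded_ops_def)
  have "calkin_proj T \<in> Units calkin_algebra \<longleftrightarrow> (\<exists>B\<in>carrier bounded_ops.
      B \<otimes>\<^bsub>bounded_ops\<^esub> T \<ominus>\<^bsub>bounded_ops\<^esub> \<one>\<^bsub>bounded_ops\<^esub> \<in> compact_ops \<and>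
      T \<otimes>\<^bsub>bounded_ops\<^esub> B \<ominus>\<^bsub>bounded_ops\<^esub> \<one>\<^bsub>bounded_ops\<^esub> \<in> compact_ops)"
    unfolding Units_calkin calkin_proj_def by (rule ideal.Quot_unit_iff[OF ideal_compact_ops T])
  also have "\<dots> \<longleftrightarrow> (\<exists>B. parametrix T B)"
    unfolding parametrix_def Bex_def by (simp add: minus_one T cong: conj_cong)
  finally show ?thesis .
qed

theorem calkin_proj_unit_iff_fredholm:
  fixes T :: "'v::right_quaternionic_hilbert \<Rightarrow> 'v"
  assumes T: "T \<in> carrier bounded_ops"
  shows "calkin_proj T \<in> Units calkin_algebra \<longleftrightarrow> T \<in> fredholm_ops"
proof -
  note ker = qsubspace_kernel[OF T] and ran = qsubspace_image[OF T qsubspace_UNIV]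
  have fredholm: "T \<in> fredholm_ops \<longleftrightarrow> (\<exists>S. finite S \<and> qspan S = {x. T x = 0}) \<and>
      (\<exists>C. finite C \<and> (\<forall>z. \<exists>w\<in>range T. \<exists>c\<in>qspan C. z = w + c))"
    unfolding fredholm_ops_def quat_finite_dim_sub_space_iff[OF ker, symmetric]
      quat_finite_dim_quotient_space_iff[OF ran, symmetric] using T by simp
  have "(\<exists>B. parametrix T B) \<longleftrightarrow> T \<in> fredholm_ops"
  proof
    assume "\<exists>B. parametrix T B"
    then obtain B where "parametrix T B" ..
    then obtain S C where SC: "finite S" "{x. T x = 0} \<subseteq> qspan S" "finite C"
      "\<And>z. \<exists>x. \<exists>c\<in>qspan C. z = T x + c"
      by (rule parametrix_imp_finite) (rule that)
    obtain S' where "finite S'" "qspan S' = {x. T x = 0}"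
      by (rule qsubspace_of_finite_qspan[OF SC(1) ker SC(2)])
    moreover have "\<exists>w\<in>range T. \<exists>c\<in>qspan C. z = w + c" for z
      using SC(4)[of z] by (elim exE) (rule bexI[OF _ rangeI])
    ultimately show "T \<in> fredholm_ops" unfolding fredholm using SC(3) by (intro conjI exI allI)
  next
    assume "T \<in> fredholm_ops"
    then obtain S C where S: "finite S" "qspan S = {x. T x = 0}"
      and C: "finite C" "\<forall>z. \<exists>w\<in>range T. \<exists>c\<in>qspan C. z = w + c"
      unfolding fredholm by (elim conjE exE) (rule that)
    have "\<exists>x. \<exists>c\<in>qspan C. z = T x + c" for z
      using C(2)[rule_format, of z] by (elim bexE imageE) (intro exI bexI, simp_all)
    then show "\<exists>B. parametrix T B"
      by (rule exists_parametrix[OF T S(1) S(2)[symmetric] C(1)]) (rule exI)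
  qed
  then show ?thesis unfolding calkin_proj_unit_iff_parametrix[OF T] .
qed

theorem corollary7p8:
  fixes A :: "'v::right_quaternionic_hilbert \<Rightarrow> 'v"
  assumes "separable_space (euclidean :: 'v topology)"
    and "A \<in> carrier bounded_ops"
  shows "essential_S_spectrum A = {q. S_poly bounded_ops q A \<in> carrier bounded_ops - fredholm_ops}"
  using S_poly_calkin[OF assms(2)] calkin_proj_unit_iff_fredholm[OF S_poly_calkin(1)[OF assms(2)]]
  by (simp add: essential_S_spectrum_def S_spectrum_def)

end
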